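(* Every homogeneous polynomial of degree $6$ in $\mathbb{C}[x_{ijk}\mid 1\le i,j,k\le 3]$ that is invariant under the action of $SL_3(\mathbb{C})\times SL_3(\mathbb{C})\times SL_3(\mathbb{C})$ on $3\times3\times3$ arrays $X=(x_{ijk})$ is a scalar multiple of $$\begin{aligned}&-10\,\mathcal{O}^+(x_{123}x_{132}x_{213}x_{231}x_{312}x_{321})-4\,\mathcal{O}^+(x_{132}x_{133}x_{213}x_{221}x_{311}x_{322})\\&-2\,\mathcal{O}^+(x_{133}^2x_{221}x_{222}x_{311}x_{312})+\mathcal{O}^+(x_{133}^2x_{222}^2x_{311}^2)\\&+2\,\mathcal{O}^+(x_{132}x_{133}x_{221}x_{223}x_{311}x_{312})+2\,\mathcal{O}^+(x_{132}x_{133}x_{213}x_{222}x_{311}x_{321})\\&+4\,\mathcal{O}^+(x_{133}^2x_{212}x_{221}x_{311}x_{322})+8\,\mathcal{O}^+(x_{123}x_{132}x_{213}x_{231}x_{311}x_{322}).\end{aligned}$$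
   Context: A triple $(A,B,C)$ of invertible $3\times 3$ complex matrices acts on $\mathbb{C}[x_{ijk}]$ by algebra automorphisms with $(A,B,C)\cdot x_{ijk}=\sum_{p,q,r=1}^3 a_{pi}b_{qj}c_{rk}x_{pqr}$. A polynomial $f$ is an invariant if $(A,B,C)\cdot f=f$ whenever $\det A=\det B=\det C=1$. For a $3\times3\times3$ array $E=(e_{ijk})$ of non-negative integers, $M(E)=\prod_{i,j,k}x_{ijk}^{e_{ijk}}$. The finite group $G=(S_3\times S_3\times S_3)\rtimes S_3$ acts on arrays by $((\alpha,\beta,\gamma)\cdot E)_{i,j,k}=e_{\alpha(i),\beta(j),\gamma(k)}$, and $\delta$ in the last $S_3$ permutes the three directions: $(\delta\cdot E)_{t_1,t_2,t_3}=e_{t_{\delta(1)},t_{\delta(2)},t_{\delta(3)}}$. The orbit of $M=M(E)$ is $\mathcal{O}(M)=\{M(g\cdot E)\mid g\in G\}$ and the symmetric orbit sum is $\mathcal{O}^+(M)=\frac{|\mathcal{O}(M)|}{|G|}\sum_{g\in G}M(g\cdot E)$. *)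

theory Defs
  imports "HOL-Analysis.Analysis" "HOL-Library.Poly_Mapping"
begin

(* The indices 1, 2, 3 are the elements of the numeral type 3 (where 3 = 0), as for the
   library's 3 x 3 matrices.  Polynomials in the x_ijk are finitely supported maps from
   exponent vectors to coefficients, with the convolution product of Poly_Mapping. *)
type_synonym idx = "3 \<times> 3 \<times> 3"
type_synonym cpoly = "(idx \<Rightarrow>\<^sub>0 nat) \<Rightarrow>\<^sub>0 complex"
type_synonym array = "idx \<Rightarrow> nat"

definition const :: "complex \<Rightarrow> cpoly" where
  "const c = Poly_Mapping.single 0 c"

definition var :: "idx \<Rightarrow> cpoly" where
  "var t = Poly_Mapping.single (Poly_Mapping.single t 1) 1"

abbreviation X :: "3 \<Rightarrow> 3 \<Rightarrow> 3 \<Rightarrow> cpoly" where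
  "X i j k \<equiv> var (i, j, k)"

definition homogeneous :: "nat \<Rightarrow> cpoly \<Rightarrow> bool" where
  "homogeneous d f \<longleftrightarrow>
     (\<forall>m \<in> Poly_Mapping.keys f. (\<Sum>t\<in>UNIV. Poly_Mapping.lookup m t) = d)"

(* The algebra endomorphism sending each variable var t to h t; see subst_hom below. *)
definition subst :: "(idx \<Rightarrow> cpoly) \<Rightarrow> cpoly \<Rightarrow> cpoly" where
  "subst h f = (\<Sum>m \<in> Poly_Mapping.keys f.
     const (Poly_Mapping.lookup f m) * (\<Prod>t\<in>UNIV. h t ^ Poly_Mapping.lookup m t))"

definition var_image ::
    "complex^3^3 \<Rightarrow> complex^3^3 \<Rightarrow> complex^3^3 \<Rightarrow> idx \<Rightarrow> cpoly" where
  "var_image A B C = (\<lambda>(i, j, k).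
     \<Sum>p\<in>UNIV. \<Sum>q\<in>UNIV. \<Sum>r\<in>UNIV. const (A $ p $ i * B $ q $ j * C $ r $ k) * X p q r)"

definition act ::
    "complex^3^3 \<Rightarrow> complex^3^3 \<Rightarrow> complex^3^3 \<Rightarrow> cpoly \<Rightarrow> cpoly" where
  "act A B C = subst (var_image A B C)"

definition SL_invariant :: "cpoly \<Rightarrow> bool" where
  "SL_invariant f \<longleftrightarrow>
     (\<forall>A B C. det A = 1 \<and> det B = 1 \<and> det C = 1 \<longrightarrow> act A B C f = f)"

definition monom_of :: "array \<Rightarrow> cpoly" where
  "monom_of E = (\<Prod>t\<in>UNIV. var t ^ E t)"

fun component :: "idx \<Rightarrow> 3 \<Rightarrow> 3" where
  "component (i, j, k) d = (if d = 1 then i else if d = 2 then j else k)"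

type_synonym sym = "((3 \<Rightarrow> 3) \<times> (3 \<Rightarrow> 3) \<times> (3 \<Rightarrow> 3)) \<times> (3 \<Rightarrow> 3)"

definition S3 :: "(3 \<Rightarrow> 3) set" where
  "S3 = {p. p permutes UNIV}"

(* The underlying set of the semidirect product (S3 x S3 x S3) : S3.  Its group law is never
   needed, since orbits and orbit sums only range over this set. *)
definition G :: "sym set" where
  "G = (S3 \<times> S3 \<times> S3) \<times> S3"

definition permute_indices :: "(3 \<Rightarrow> 3) \<times> (3 \<Rightarrow> 3) \<times> (3 \<Rightarrow> 3) \<Rightarrow> array \<Rightarrow> array" where
  "permute_indices = (\<lambda>(\<alpha>, \<beta>, \<gamma>) E (i, j, k). E (\<alpha> i, \<beta> j, \<gamma> k))"

definition permute_directions :: "(3 \<Rightarrow> 3) \<Rightarrow> array \<Rightarrow> array" where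
  "permute_directions \<delta> E =
     (\<lambda>t. E (component t (\<delta> 1), component t (\<delta> 2), component t (\<delta> 3)))"

definition G_act :: "sym \<Rightarrow> array \<Rightarrow> array" where
  "G_act = (\<lambda>(\<pi>, \<delta>) E. permute_indices \<pi> (permute_directions \<delta> E))"

(* The exponent array of a monomial; unique by inj_monom_of below.  Junk on non-monomials. *)
definition exponents :: "cpoly \<Rightarrow> array" where
  "exponents M = (THE E. M = monom_of E)"

definition orbit :: "cpoly \<Rightarrow> cpoly set" where
  "orbit M = {monom_of (G_act g (exponents M)) | g. g \<in> G}"

definition orbit_sum :: "cpoly \<Rightarrow> cpoly" ("\<O>\<^sup>+") where
  "orbit_sum M = const (of_nat (card (orbit M)) / of_nat (card G)) *
     (\<Sum>g\<in>G. monom_of (G_act g (exponents M)))"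


lemma const_simps [simp]:
  "const 0 = 0" "const 1 = 1" "const (a + b) = const a + const b"
  "const (a * b) = const a * const b"
  by (simp_all add: const_def single_add mult_single)

lemma var_power: "var t ^ n = Poly_Mapping.single (Poly_Mapping.single t n) 1"
  by (induction n) (simp_all add: var_def mult_single flip: single_add)

lemma prod_single_1:
  "finite S \<Longrightarrow> (\<Prod>t\<in>S. Poly_Mapping.single (h t) (1 :: complex)) =
     Poly_Mapping.single (\<Sum>t\<in>S. h t :: idx \<Rightarrow>\<^sub>0 nat) 1"
  by (induction S rule: finite_induct) (simp_all add: mult_single)

lemma monom_of_eq:
  "monom_of E = Poly_Mapping.single (Poly_Mapping.Abs_poly_mapping E) 1"
proof -
  have "(\<Sum>t\<in>UNIV. Poly_Mapping.single t (E t)) = Poly_Mapping.Abs_poly_mapping E"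
    by (rule poly_mapping_eqI)
      (simp add: lookup_sum lookup_single when_def)
  then show ?thesis
    by (simp add: monom_of_def var_power prod_single_1)
qed

lemma inj_monom_of: "inj monom_of"
proof (rule injI)
  fix E E' assume "monom_of E = monom_of E'"
  then have "Poly_Mapping.Abs_poly_mapping E = Poly_Mapping.Abs_poly_mapping E'"
    unfolding monom_of_eq by (metis lookup_single_eq lookup_single_not_eq zero_neq_one)
  then have "Poly_Mapping.lookup (Poly_Mapping.Abs_poly_mapping E) =
      Poly_Mapping.lookup (Poly_Mapping.Abs_poly_mapping E')" by simp
  then show "E = E'" by simp
qed

lemma exponents_monom_of [simp]: "exponents (monom_of E) = E"
  unfolding exponents_def using inj_monom_of by (auto dest: injD)

lemma subst_superset:
  assumes "finite K" "Poly_Mapping.keys f \<subseteq> K"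
  shows "subst h f = (\<Sum>m\<in>K. const (Poly_Mapping.lookup f m) *
           (\<Prod>t\<in>UNIV. h t ^ Poly_Mapping.lookup m t))"
  unfolding subst_def using assms
  by (intro sum.mono_neutral_left) (auto simp: in_keys_iff)

lemma subst_single:
  "subst h (Poly_Mapping.single m c) = const c * (\<Prod>t\<in>UNIV. h t ^ Poly_Mapping.lookup m t)"
  by (subst subst_superset[of "{m}"]) auto

lemma subst_add: "subst h (f + g) = subst h f + subst h g"
proof -
  let ?K = "Poly_Mapping.keys f \<union> Poly_Mapping.keys g"
  have "Poly_Mapping.keys (f + g) \<subseteq> ?K" by (rule keys_add)
  then show ?thesis
    by (simp add: subst_superset[of ?K] lookup_add distrib_right sum.distrib)
qed

lemma subst_single_mult:
  "subst h (Poly_Mapping.single m c * Poly_Mapping.single n d) =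
     subst h (Poly_Mapping.single m c) * subst h (Poly_Mapping.single n d)"
  by (simp add: mult_single subst_single lookup_add power_add prod.distrib mult_ac)

lemma cpoly_induct [case_names zero add_single]:
  fixes f :: cpoly
  assumes "P 0" "\<And>m c f. P f \<Longrightarrow> P (Poly_Mapping.single m c + f)"
  shows "P f"
proof (induction f rule: Poly_Mapping.update_induct)
  case (update f m c)
  then have "Poly_Mapping.update m c f = Poly_Mapping.single m c + f"
    by (intro poly_mapping_eqI)
      (auto simp: lookup_update lookup_add lookup_single when_def in_keys_iff)
  with update assms(2) show ?case by simp
qed (rule assms(1))

lemma subst_0 [simp]: "subst h 0 = 0"
  by (simp add: subst_def)

lemma subst_mult: "subst h (f * g) = subst h f * subst h g"
proof (induction f rule: cpoly_induct)
  case (add_single m c f)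
  have "subst h (Poly_Mapping.single m c * g) = subst h (Poly_Mapping.single m c) * subst h g"
    by (induction g rule: cpoly_induct)
      (simp_all add: subst_single_mult distrib_left subst_add)
  with add_single show ?case by (simp add: distrib_right subst_add)
qed simp

lemma subst_hom:
  "subst h (var t) = h t" "subst h (const c) = const c"
  "subst h (f + g) = subst h f + subst h g" "subst h (f * g) = subst h f * subst h g"
proof -
  have "(\<Prod>s\<in>UNIV. h s ^ (1 when t = s)) = (\<Prod>s\<in>UNIV. if t = s then h s else 1)"
    by (intro prod.cong) (auto simp: when_def)
  then show "subst h (var t) = h t"
    by (simp add: var_def subst_single lookup_single)
  show "subst h (const c) = const c"
    by (simp add: const_def[of c] subst_single)
qed (rule subst_add subst_mult)+

end

theory Submission
  imports Defs "HOL-Combinatorics.Multiset_Permutations"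
begin

text \<open>
  The idea is to determine all coefficients of an invariant from a single one. Polarisation replaces a
  homogeneous polynomial \<open>f\<close> of degree \<open>6\<close> by a symmetric function \<open>T = polar f\<close> on words of six
  index triples: the coefficient of a monomial is divided by the number of words that spell it. A
  linear substitution of the variables then acts on \<open>T\<close> by products of matrix entries
  (\<open>polar_subst\<close>), and three kinds of matrices of determinant \<open>1\<close> suffice.

  \<^item> Diagonal matrices: \<open>T\<close> vanishes on a word unless, in each of the three directions, each of
    the three labels occurs exactly twice (\<open>invariant_form_balanced\<close>).
  \<^item> Signed permutation matrices: \<open>T\<close> does not depend on the names of the labels
    (\<open>invariant_form_relabel\<close>). So \<open>T\<close> is a function of three perfect matchings of the six
    positions, one for each direction, and is unchanged when the positions are permuted.
  \<^item> A transvection: if two matchings are kept and the third runs through the three matchings that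
    contain a given edge, the values of \<open>T\<close> sum to zero (\<open>exchange_relation\<close>).

  Up to permutations of positions and of the three directions, there are eight triples of perfect
  matchings of six points (\<open>classification\<close>), and they are the eight monomials of the theorem. The
  simplest one consists of three equal matchings and belongs to the word \<open>diagonal\<close>. Starting from
  it, seven exchange relations determine the value of \<open>T\<close> on each of the others as a fixed multiple
  (\<open>rep_ratios\<close>). The exchange relations hold for the composition of \<open>T\<close> with any symmetry as well
  (\<open>invariant_form_idx_map\<close>), and all symmetries fix the value at the diagonal word
  (\<open>diagonal_invariant\<close>); therefore these multiples are the same throughout each orbit, and \<open>f\<close>
  inherits a symmetry in the three directions.

  On the other side, an orbit sum has coefficient \<open>1\<close> on its orbit and \<open>0\<close> elsewhere
  (\<open>orbit_sum_coefficient\<close>), and the eight orbits are distinguished by the trace of the cube of the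
  matrix counting common indices (\<open>traces\<close>). Multiplying the values of \<open>T\<close> by the numbers of
  words that spell the monomials gives the coefficients of the theorem.
\<close>

section \<open>Homogeneous polynomials as symmetric forms on words\<close>
definition words :: "nat \<Rightarrow> idx list set" where
  "words d = {ws. length ws = d}"

lemma finite_words [simp]: "finite (words d)"
  using finite_lists_length_eq[of "UNIV :: idx set" d] by (simp add: words_def)

lemma sum_words_Suc: "(\<Sum>ws\<in>words (Suc d). F ws) = (\<Sum>u\<in>UNIV. \<Sum>us\<in>words d. F (u # us))"
proof -
  have "words (Suc d) = (\<lambda>(u, us). u # us) ` (UNIV \<times> words d)"
    by (auto simp: words_def length_Suc_conv image_iff)
  moreover have "inj_on (\<lambda>(u, us). u # us) (UNIV \<times> words d)"
    by (auto simp: inj_on_def)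
  ultimately show ?thesis
    by (simp add: sum.reindex sum.cartesian_product case_prod_unfold)
qed

definition exponent_of :: "idx list \<Rightarrow> idx \<Rightarrow>\<^sub>0 nat" where
  "exponent_of ws = (\<Sum>t\<leftarrow>ws. Poly_Mapping.single t 1)"

lemma lookup_exponent_of: "Poly_Mapping.lookup (exponent_of ws) t = count (mset ws) t"
  by (induction ws) (auto simp: exponent_of_def lookup_add lookup_single when_def)

lemma exponent_of_eq_iff: "exponent_of ws = exponent_of vs \<longleftrightarrow> mset ws = mset vs"
  by (metis lookup_exponent_of multiset_eqI poly_mapping_eqI)

lemma sum_count: "(\<Sum>t\<in>UNIV. count (mset ws) t) = length (ws :: idx list)"
proof (induction ws)
  case (Cons w ws)
  have "(\<Sum>t\<in>UNIV. if w = t then Suc (count (mset ws) t) else count (mset ws) t)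
      = (\<Sum>t\<in>UNIV. count (mset ws) t + (if w = t then 1 else 0))"
    by (intro sum.cong) auto
  with Cons show ?case by (simp add: sum.distrib)
qed simp

lemma ex_word:
  obtains ws where "exponent_of ws = m" "length ws = (\<Sum>t\<in>UNIV. Poly_Mapping.lookup m t)"
proof -
  obtain ws where ws: "mset ws = Abs_multiset (Poly_Mapping.lookup m)"
    using ex_mset by blast
  have "exponent_of ws = m"
    by (rule poly_mapping_eqI) (simp add: lookup_exponent_of ws)
  moreover from this have "length ws = (\<Sum>t\<in>UNIV. Poly_Mapping.lookup m t)"
    using sum_count[of ws] by (auto simp: lookup_exponent_of)
  ultimately show ?thesis by (rule that)
qed

definition rearrangements :: "idx list \<Rightarrow> nat" where
  "rearrangements ws = card (permutations_of_multiset (mset ws))"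

lemma rearrangements_pos: "rearrangements ws > 0"
  by (simp add: rearrangements_def card_gt_0_iff)

text \<open>
  A monomial is the multiset of the letters of a word, so many words share one monomial. Dividing a
  coefficient by their number spreads it evenly over these words and turns a
  homogeneous polynomial into the symmetric multilinear form that restricts to it on the diagonal.
\<close>
definition polar :: "cpoly \<Rightarrow> idx list \<Rightarrow> complex" where
  "polar f ws = Poly_Mapping.lookup f (exponent_of ws) / of_nat (rearrangements ws)"

definition symmetric_form :: "(idx list \<Rightarrow> complex) \<Rightarrow> bool" where
  "symmetric_form S \<longleftrightarrow> (\<forall>ws vs. mset ws = mset vs \<longrightarrow> S ws = S vs)"

lemma symmetric_polar: "symmetric_form (polar f)"
  unfolding symmetric_form_def
proof safe
  fix ws vs :: "idx list" assume "mset ws = mset vs"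
  then have "exponent_of ws = exponent_of vs" by (simp add: exponent_of_eq_iff)
  with \<open>mset ws = mset vs\<close> show "polar f ws = polar f vs"
    by (simp add: polar_def rearrangements_def)
qed

lemma const_times_single: "const c * Poly_Mapping.single m 1 = Poly_Mapping.single m c"
  by (simp add: const_def mult_single)

text \<open>
  A polynomial has only one symmetric form: every word with the exponent of \<open>ws\<close> contributes the
  same value, and the normalisation in \<open>polar\<close> cancels their number. This lets coefficients of
  words be compared even though words are not linearly independent as monomials.
\<close>
lemma polar_sum_words:
  assumes S: "symmetric_form S" and ws: "length ws = d"
  shows "polar (\<Sum>vs\<in>words d. const (S vs) * Poly_Mapping.single (exponent_of vs) 1) ws = S ws"
proof -
  have "Poly_Mapping.lookup (\<Sum>vs\<in>words d. const (S vs) * Poly_Mapping.single (exponent_of vs) 1) (exponent_of ws)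
      = (\<Sum>vs\<in>words d. if mset vs = mset ws then S vs else 0)"
    by (simp add: lookup_sum const_times_single lookup_single when_def exponent_of_eq_iff)
  also have "\<dots> = (\<Sum>vs\<in>permutations_of_multiset (mset ws). S ws)"
  proof (rule sum.mono_neutral_cong_right)
    show "permutations_of_multiset (mset ws) \<subseteq> words d"
      using ws by (auto simp: words_def permutations_of_multiset_def dest: mset_eq_length)
    show "(if mset vs = mset ws then S vs else 0) = S ws"
      if "vs \<in> permutations_of_multiset (mset ws)" for vs
      using S[unfolded symmetric_form_def, rule_format, of vs ws] that
      by (simp add: permutations_of_multiset_def)
  qed (auto simp: permutations_of_multiset_def)
  finally show ?thesis
    using rearrangements_pos[of ws] by (simp add: polar_def rearrangements_def)
qed

lemma polar_expansion:
  assumes "homogeneous d f"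
  shows "f = (\<Sum>ws\<in>words d. const (polar f ws) * Poly_Mapping.single (exponent_of ws) 1)" (is "f = ?g")
proof (rule poly_mapping_eqI)
  fix m
  obtain ws where ws: "exponent_of ws = m" "length ws = (\<Sum>t\<in>UNIV. Poly_Mapping.lookup m t)"
    by (rule ex_word)
  show "Poly_Mapping.lookup f m = Poly_Mapping.lookup ?g m"
  proof (cases "length ws = d")
    case True
    then have "polar ?g ws = polar f ws"
      by (intro polar_sum_words symmetric_polar)
    then show ?thesis
      using rearrangements_pos[of ws] by (simp add: polar_def ws)
  next
    case False
    then have "\<forall>vs\<in>words d. exponent_of vs \<noteq> m"
      by (auto simp: words_def exponent_of_eq_iff simp flip: ws dest: mset_eq_length)
    moreover have "Poly_Mapping.lookup f m = 0"
      using assms False ws by (auto simp: homogeneous_def in_keys_iff)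
    ultimately show ?thesis
      by (auto simp: lookup_sum const_times_single lookup_single when_def intro!: sum.neutral[symmetric])
  qed
qed

lemma subst_sum: "subst h (\<Sum>x\<in>I. g x) = (\<Sum>x\<in>I. subst h (g x))"
  by (induction I rule: infinite_finite_induct) (simp_all add: subst_add)

lemma subst_one: "subst h 1 = 1"
  using subst_hom(2)[of h 1] by simp

lemma monomial_Cons: "Poly_Mapping.single (exponent_of (w # ws)) (1::complex) = var w * Poly_Mapping.single (exponent_of ws) 1"
  by (simp add: exponent_of_def var_def mult_single)

lemma monomial_Nil: "Poly_Mapping.single (exponent_of []) 1 = 1"
  by (simp add: exponent_of_def)

text \<open>
  With \<open>H\<close> the matrix of a linear substitution of the variables, this is the corresponding entry
  of its tensor power.
\<close>
definition weight :: "(idx \<Rightarrow> idx \<Rightarrow> complex) \<Rightarrow> idx list \<Rightarrow> idx list \<Rightarrow> complex" where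
  "weight H ws us = prod_list (map2 H ws us)"

lemma weight_simps [simp]: "weight H [] [] = 1" "weight H (w # ws) (u # us) = H w u * weight H ws us"
  by (simp_all add: weight_def)

lemma subst_word:
  assumes "\<And>t. h t = (\<Sum>u\<in>UNIV. const (H t u) * var u)"
  shows "subst h (Poly_Mapping.single (exponent_of ws) 1) =
    (\<Sum>us\<in>words (length ws). const (weight H ws us) * Poly_Mapping.single (exponent_of us) 1)"
proof (induction ws)
  case Nil
  have "words 0 = {[]}" by (auto simp: words_def)
  then show ?case by (simp add: monomial_Nil subst_one)
next
  case (Cons w ws)
  show ?case
    unfolding monomial_Cons subst_mult subst_hom(1) Cons assms[of w]
    by (simp add: sum_words_Suc sum_product monomial_Cons mult_ac)
qed

lemma weight_permute:
  assumes "p permutes {..<d}" "length ws = d" "length us = d"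
  shows "weight H (permute_list p ws) (permute_list p us) = weight H ws us"
proof -
  have "map2 H (permute_list p ws) (permute_list p us) = permute_list p (map2 H ws us)"
    using assms by (simp add: permute_list_map permute_list_zip)
  moreover have "mset (permute_list p (map2 H ws us)) = mset (map2 H ws us)"
    using assms by simp
  ultimately show ?thesis
    unfolding weight_def by (metis prod_mset_prod_list)
qed

text \<open>
  Permuting the positions of \<open>us\<close> can be undone by permuting the positions of the summation word in
  the same way, which changes neither the form nor the weight.
\<close>
lemma symmetric_transform:
  assumes S: "symmetric_form S"
  shows "symmetric_form (\<lambda>us. \<Sum>ws\<in>words (length us). S ws * weight H ws us)"
  unfolding symmetric_form_def
proof safe
  fix us vs :: "idx list" assume eq: "mset us = mset vs"
  then obtain p where p: "p permutes {..<length vs}" "permute_list p vs = us"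
    by (rule mset_eq_permutation)
  let ?d = "length vs"
  have l: "length us = ?d" using eq by (rule mset_eq_length)
  have q: "inv p permutes {..<?d}" using p(1) by (rule permutes_inv)
  have *: "permute_list (inv p) (permute_list p ws) = ws"
       "permute_list p (permute_list (inv p) ws) = ws" if "length ws = ?d" for ws :: "idx list"
  proof -
    have "p permutes {..<length ws}" "inv p permutes {..<length ws}"
      using p(1) q that by simp_all
    then show "permute_list (inv p) (permute_list p ws) = ws"
       "permute_list p (permute_list (inv p) ws) = ws"
      by (metis permute_list_compose permutes_inv_o permute_list_id)+
  qed
  have "(\<Sum>ws\<in>words ?d. S ws * weight H ws us) = (\<Sum>ws\<in>words ?d. S ws * weight H ws vs)"
  proof (rule sum.reindex_bij_witness[of _ "permute_list p" "permute_list (inv p)"])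
    fix ws assume ws: "ws \<in> words ?d"
    then have "weight H (permute_list (inv p) ws) vs =
      weight H (permute_list p (permute_list (inv p) ws)) (permute_list p vs)"
      by (intro weight_permute[OF p(1), symmetric]) (auto simp: words_def)
    then have "weight H (permute_list (inv p) ws) vs = weight H ws us"
      using ws p by (simp add: * words_def)
    moreover have "S (permute_list (inv p) ws) = S ws"
      using S[unfolded symmetric_form_def, rule_format, of "permute_list (inv p) ws" ws] q ws
      by (simp add: words_def)
    ultimately show "S (permute_list (inv p) ws) * weight H (permute_list (inv p) ws) vs = S ws * weight H ws us"
      by simp
  qed (use p(1) q in \<open>auto simp: words_def *\<close>)
  then show "(\<Sum>ws\<in>words (length us). S ws * weight H ws us) =
    (\<Sum>ws\<in>words (length vs). S ws * weight H ws vs)" by (simp add: l)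
qed

text \<open>
  Expanding each product of linear forms gives an expression of the substituted polynomial as a sum
  over words whose coefficients are again symmetric, so they are its form. Thus a substitution, which
  is complicated on coefficients, is linear with product weights on forms.
\<close>
lemma polar_subst:
  assumes "homogeneous d f" "\<And>t. h t = (\<Sum>u\<in>UNIV. const (H t u) * var u)" "length us = d"
  shows "polar (subst h f) us = (\<Sum>ws\<in>words d. polar f ws * weight H ws us)"
proof -
  have "subst h f = (\<Sum>ws\<in>words d. const (polar f ws) *
     (\<Sum>us\<in>words d. const (weight H ws us) * Poly_Mapping.single (exponent_of us) 1))"
    by (subst polar_expansion[OF assms(1)])
       (simp add: subst_sum subst_mult subst_hom(2) subst_word[OF assms(2)] words_def)
  also have "\<dots> = (\<Sum>us\<in>words d. \<Sum>ws\<in>words d.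
      const (polar f ws) * (const (weight H ws us) * Poly_Mapping.single (exponent_of us) 1))"
    unfolding sum_distrib_left by (rule sum.swap)
  also have "\<dots> = (\<Sum>us\<in>words d. const (\<Sum>ws\<in>words (length us). polar f ws * weight H ws us)
      * Poly_Mapping.single (exponent_of us) 1)"
  proof (intro sum.cong refl)
    fix us assume "us \<in> words d"
    have "const (\<Sum>ws\<in>I. F ws) = (\<Sum>ws\<in>I. const (F ws))" for I and F :: "idx list \<Rightarrow> complex"
      by (induction I rule: infinite_finite_induct) simp_all
    then show "(\<Sum>ws\<in>words d. const (polar f ws) * (const (weight H ws us) * Poly_Mapping.single (exponent_of us) 1))
       = const (\<Sum>ws\<in>words (length us). polar f ws * weight H ws us) * Poly_Mapping.single (exponent_of us) 1"
      using \<open>us \<in> words d\<close> by (simp add: words_def sum_distrib_right mult.assoc)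
  qed
  finally show ?thesis
    using polar_sum_words[OF symmetric_transform[OF symmetric_polar] assms(3)] assms(3) by simp
qed

section \<open>The symmetry group as permutations of index triples\<close>
lemma prod_3: "(\<Prod>d\<in>(UNIV :: 3 set). F d) = F 1 * F 2 * F 3" for F :: "3 \<Rightarrow> 'a::comm_monoid_mult"
  unfolding UNIV_3 by (simp add: mult.assoc)

lemma idx_eqI:
  assumes "\<And>d. component t d = component u d"
  shows "t = u"
  using assms[of 1] assms[of 2] assms[of 3] by (cases t; cases u) simp

lemma component_tuple: "component (c 1, c 2, c 3) d = c d"
  using exhaust_3[of d] by auto

lemma ex_idx: "\<exists>t. \<forall>d. component t d = c d"
  using component_tuple by metis

text \<open>
  The permutation of the labels that \<open>g\<close> applies in direction \<open>d\<close>. Treating the three directions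
  as an argument makes the semidirect product structure uniform; see \<open>component_idx_map\<close>.
\<close>
fun relabeling :: "sym \<Rightarrow> 3 \<Rightarrow> 3 \<Rightarrow> 3" where
  "relabeling ((\<alpha>, \<beta>, \<gamma>), \<delta>) d = (if d = 1 then \<alpha> else if d = 2 then \<beta> else \<gamma>)"

text \<open>
  The permutation of index triples by which \<open>g\<close> acts on arrays; \<open>G_act_eq\<close> below says that the
  action is precomposition with it.
\<close>
definition idx_map :: "sym \<Rightarrow> idx \<Rightarrow> idx" where
  "idx_map g t = (let c = (\<lambda>d. relabeling g (snd g d) (component t (snd g d))) in (c 1, c 2, c 3))"

lemma component_idx_map [simp]:
  "component (idx_map g t) d = relabeling g (snd g d) (component t (snd g d))"
  unfolding idx_map_def Let_def by (rule component_tuple)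

lemma G_act_eq: "G_act g E = E \<circ> idx_map g"
proof
  fix t
  obtain \<alpha> \<beta> \<gamma> \<delta> where g: "g = ((\<alpha>, \<beta>, \<gamma>), \<delta>)" by (metis prod.exhaust)
  obtain i j k :: 3 where t: "t = (i, j, k)" by (metis prod.exhaust)
  have "component (\<alpha> i, \<beta> j, \<gamma> k) d = relabeling g d (component t d)" for d
    by (simp add: g t)
  then show "G_act g E t = (E \<circ> idx_map g) t"
    by (simp add: G_act_def permute_indices_def permute_directions_def idx_map_def g t Let_def del: component.simps)
qed

lemma sym_cases:
  fixes g :: sym
  obtains \<alpha> \<beta> \<gamma> \<delta> where "g = ((\<alpha>, \<beta>, \<gamma>), \<delta>)"
  by (metis prod.exhaust)

lemma G_iff: "g \<in> G \<longleftrightarrow> (\<forall>d. relabeling g d permutes UNIV) \<and> snd g permutes UNIV"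
  by (cases g rule: sym_cases) (simp add: G_def S3_def forall_3)

lemma ex_sym: "\<exists>g. (\<forall>d. relabeling g d = L d) \<and> snd g = \<delta>"
proof (intro exI conjI allI)
  show "relabeling ((L 1, L 2, L 3), \<delta>) d = L d" for d
    using exhaust_3[of d] by auto
qed simp

text \<open>
  The direction permutations compose in reversed order, and a label that ends up in direction \<open>d\<close>
  after \<open>h\<close> came from direction \<open>snd h d\<close>; this explains the relabelings of the composition.
\<close>
lemma idx_map_comp:
  assumes "g \<in> G" "h \<in> G"
  obtains k where "k \<in> G" "idx_map k = idx_map g \<circ> idx_map h"
proof -
  obtain k where k: "\<And>d. relabeling k d = relabeling g (inv (snd h) d) \<circ> relabeling h d"
      "snd k = snd h \<circ> snd g"
    using ex_sym[of "\<lambda>d. relabeling g (inv (snd h) d) \<circ> relabeling h d" "snd h \<circ> snd g"] by blast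
  have "k \<in> G"
    using assms by (auto simp: G_iff k intro!: permutes_compose)
  moreover have "idx_map k t = (idx_map g \<circ> idx_map h) t" for t
    by (rule idx_eqI) (use assms in \<open>simp add: k G_iff permutes_inverses[where S = UNIV]\<close>)
  ultimately show ?thesis by (intro that) auto
qed

lemma idx_map_inv:
  assumes "g \<in> G"
  obtains k where "k \<in> G" "\<And>t. idx_map k (idx_map g t) = t" "\<And>t. idx_map g (idx_map k t) = t"
proof -
  obtain k where k: "\<And>d. relabeling k d = inv (relabeling g (snd g d))" "snd k = inv (snd g)"
    using ex_sym[of "\<lambda>d. inv (relabeling g (snd g d))" "inv (snd g)"] by blast
  have "k \<in> G"
    using assms by (auto simp: G_iff k intro!: permutes_inv)
  moreover have "idx_map k (idx_map g t) = t" "idx_map g (idx_map k t) = t" for t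
    by (rule idx_eqI, use assms in \<open>simp add: k G_iff permutes_inverses[where S = UNIV]\<close>)+
  ultimately show ?thesis by (rule that)
qed

lemma id_in_G: "((id, id, id), id) \<in> G" "idx_map ((id, id, id), id) = id"
proof -
  show "idx_map ((id, id, id), id) = id"
    by (rule ext, rule idx_eqI) simp
qed (simp add: G_iff permutes_id)

lemma bij_idx_map: "g \<in> G \<Longrightarrow> bij (idx_map g)"
  by (metis idx_map_inv bij_betw_byWitness[of UNIV _ _ UNIV] subset_UNIV)

text \<open>
  The direction permutation is visible in \<open>idx_map g\<close>: output component \<open>d\<close> depends on input
  component \<open>snd g d\<close> and on no other. Once it is known, so are the relabelings.
\<close>
lemma idx_map_inj:
  assumes g: "g \<in> G" and h: "h \<in> G" and eq: "idx_map g = idx_map h"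
  shows "g = h"
proof -
  have comp: "relabeling g (snd g d) (component t (snd g d)) = relabeling h (snd h d) (component t (snd h d))" for d t
    using component_idx_map[of g t d] component_idx_map[of h t d] eq by simp
  have snd: "snd g d = snd h d" for d
  proof (rule ccontr)
    assume ne: "snd g d \<noteq> snd h d"
    have "relabeling g (snd g d) x = relabeling h (snd h d) 1" for x
    proof -
      obtain t where "\<forall>e. component t e = (if e = snd g d then x else 1)"
        using ex_idx[of "\<lambda>e. if e = snd g d then x else 1"] by blast
      with comp[of d t] ne show ?thesis by simp
    qed
    then have eq: "relabeling g (snd g d) 1 = relabeling g (snd g d) 2" by simp
    have "inj (relabeling g (snd g d))"
      using g by (auto simp: G_iff intro: permutes_inj)
    from injD[OF this eq] show False by simp
  qed
  have "relabeling g d x = relabeling h d x" for d x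
  proof -
    obtain e where e: "snd g e = d"
      using g permutes_surj[of "snd g" UNIV] by (metis G_iff surjD)
    obtain t where "\<forall>e. component t e = x"
      using ex_idx[of "\<lambda>_. x"] by blast
    with comp[of e t] snd[of e] e show ?thesis by simp
  qed
  then have "relabeling g d = relabeling h d" for d by blast
  with this[of 1] this[of 2] this[of 3] snd show ?thesis
    by (cases g rule: sym_cases; cases h rule: sym_cases) auto
qed

section \<open>Invariant forms\<close>
definition tensor :: "(3 \<Rightarrow> complex^3^3) \<Rightarrow> idx \<Rightarrow> idx \<Rightarrow> complex" where
  "tensor M t u = (\<Prod>d\<in>UNIV. M d $ component u d $ component t d)"

text \<open>
  Invariance under the three special linear groups, expressed on forms. Letting the direction be an
  argument of \<open>M\<close> makes the invariance visibly symmetric in the three directions.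
\<close>
definition invariant_form :: "(idx list \<Rightarrow> complex) \<Rightarrow> bool" where
  "invariant_form T \<longleftrightarrow> symmetric_form T \<and>
     (\<forall>M us. (\<forall>d. det (M d) = 1) \<longrightarrow> length us = 6 \<longrightarrow>
        T us = (\<Sum>ws\<in>words 6. T ws * weight (tensor M) ws us))"

lemma invariant_form_polar:
  assumes "homogeneous 6 f" "SL_invariant f"
  shows "invariant_form (polar f)"
  unfolding invariant_form_def
proof (intro conjI allI impI)
  fix M :: "3 \<Rightarrow> complex^3^3" and us :: "idx list"
  assume M: "\<forall>d. det (M d) = 1" and us: "length us = 6"
  have img: "var_image (M 1) (M 2) (M 3) t = (\<Sum>u\<in>UNIV. const (tensor M t u) * var u)" for t
  proof -
    obtain i j k :: 3 where t: "t = (i, j, k)" by (metis prod.exhaust)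
    have "tensor M t (p, q, r) = M 1 $ p $ i * M 2 $ q $ j * M 3 $ r $ k" for p q r
      by (simp add: tensor_def prod_3 t)
    then have "var_image (M 1) (M 2) (M 3) t =
       (\<Sum>p\<in>UNIV. \<Sum>q\<in>UNIV. \<Sum>r\<in>UNIV. const (tensor M t (p, q, r)) * X p q r)"
      by (simp add: var_image_def t)
    then show ?thesis
      by (simp add: sum.cartesian_product case_prod_unfold)
  qed
  have "act (M 1) (M 2) (M 3) f = f"
    using assms(2) M by (simp add: SL_invariant_def)
  then show "polar f us = (\<Sum>ws\<in>words 6. polar f ws * weight (tensor M) ws us)"
    using polar_subst[where h = "var_image (M 1) (M 2) (M 3)" and H = "tensor M", OF assms(1) img us]
    by (simp add: act_def)
qed (rule symmetric_polar)

lemma det_conjugate_permutation: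
  fixes A :: "complex^'n^'n"
  assumes "\<sigma> permutes UNIV"
  shows "det (\<chi> i j. A $ \<sigma> i $ \<sigma> j) = det A"
proof -
  have "det (\<chi> i j. A $ \<sigma> i $ \<sigma> j) = of_int (sign \<sigma>) * det (\<chi> i j. A $ i $ \<sigma> j)"
    using det_permute_rows[OF assms, of "\<chi> i j. A $ i $ \<sigma> j"] by simp
  also have "det (\<chi> i j. A $ i $ \<sigma> j) = of_int (sign \<sigma>) * det A"
    using det_permute_columns[OF assms, of A] by simp
  finally show ?thesis
    by (simp flip: mult.assoc of_int_mult)
qed

lemma weight_map: "length ws = length us \<Longrightarrow> weight H (map \<phi> ws) (map \<psi> us) = weight (\<lambda>t u. H (\<phi> t) (\<psi> u)) ws us"
  by (induction ws us rule: list_induct2) simp_all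

text \<open>
  The matrices can be moved along with the indices: directions are permuted, and relabeling in a
  direction conjugates the matrix of that direction by a permutation matrix, which keeps its
  determinant. Hence a fact proved for all invariant forms at one word holds at all words of its orbit.
\<close>
lemma invariant_form_idx_map:
  assumes T: "invariant_form T" and g: "g \<in> G"
  shows "invariant_form (\<lambda>ws. T (map (idx_map g) ws))"
  unfolding invariant_form_def
proof (intro conjI allI impI)
  have "symmetric_form T" using T by (simp add: invariant_form_def)
  then show "symmetric_form (\<lambda>ws. T (map (idx_map g) ws))"
    unfolding symmetric_form_def by (metis mset_map)
next
  fix M :: "3 \<Rightarrow> complex^3^3" and us :: "idx list"
  assume M: "\<forall>d. det (M d) = 1" and us: "length us = 6"
  obtain k where k: "\<And>t. idx_map k (idx_map g t) = t" "\<And>t. idx_map g (idx_map k t) = t"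
    using idx_map_inv[OF g] by metis
  define \<delta> where "\<delta> = snd g"
  define \<sigma> where "\<sigma> d = inv (relabeling g (\<delta> d))" for d
  define M' where "M' d = (\<chi> p i. M (\<delta> d) $ \<sigma> d p $ \<sigma> d i)" for d
  have \<sigma>: "\<sigma> d permutes UNIV" "\<sigma> d (relabeling g (\<delta> d) x) = x" for d x
    using g by (auto simp: G_iff \<sigma>_def permutes_inv permutes_inverses[where S = UNIV])
  have "\<forall>d. det (M' d) = 1"
    using M det_conjugate_permutation[OF \<sigma>(1)] by (simp add: M'_def)
  then have "T (map (idx_map g) us) = (\<Sum>ws\<in>words 6. T ws * weight (tensor M') ws (map (idx_map g) us))"
    using T us by (simp add: invariant_form_def)
  also have "\<dots> = (\<Sum>ws\<in>words 6. T (map (idx_map g) ws) * weight (tensor M') (map (idx_map g) ws) (map (idx_map g) us))"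
    by (rule sum.reindex_bij_witness[of _ "map (idx_map g)" "map (idx_map k)"])
       (auto simp: words_def k map_idI)
  also have "\<dots> = (\<Sum>ws\<in>words 6. T (map (idx_map g) ws) * weight (tensor M) ws us)"
  proof (intro sum.cong refl)
    fix ws assume "ws \<in> words 6"
    have "tensor M' (idx_map g t) (idx_map g u) = tensor M t u" for t u
    proof -
      have "tensor M' (idx_map g t) (idx_map g u) =
        (\<Prod>d\<in>UNIV. M (\<delta> d) $ component u (\<delta> d) $ component t (\<delta> d))"
        by (simp add: tensor_def M'_def \<sigma> flip: \<delta>_def)
      also have "\<dots> = tensor M t u"
        unfolding tensor_def using g by (intro prod.permute[symmetric, unfolded o_def]) (simp add: G_iff \<delta>_def)
      finally show ?thesis .
    qed
    then show "T (map (idx_map g) ws) * weight (tensor M') (map (idx_map g) ws) (map (idx_map g) us) =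
       T (map (idx_map g) ws) * weight (tensor M) ws us"
      using us \<open>ws \<in> words 6\<close> by (simp add: words_def weight_map)
  qed
  finally show "T (map (idx_map g) us) = (\<Sum>ws\<in>words 6. T (map (idx_map g) ws) * weight (tensor M) ws us)" .
qed

text \<open>
  A permutation matrix multiplied by its own sign has determinant \<open>1\<close>, since the size \<open>3\<close> is odd;
  the signs then disappear because the degree \<open>6\<close> is even. So the form does not see which label is
  which, only which positions of the word carry equal labels.
\<close>
lemma invariant_form_relabel:
  assumes T: "invariant_form T" and g: "g \<in> G" "snd g = id" and ws: "length ws = 6"
  shows "T (map (idx_map g) ws) = T ws"
proof -
  define s :: "3 \<Rightarrow> complex" where "s d = of_int (sign (relabeling g d))" for d
  define M :: "3 \<Rightarrow> complex^3^3" where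
    "M d = (\<chi> p i. s d * of_bool (p = relabeling g d i))" for d
  have perm: "relabeling g d permutes UNIV" for d
    using g by (simp add: G_iff)
  have "det (M d) = 1" for d
  proof -
    define D :: "complex^3^3" where "D = (\<chi> p i. s d * of_bool (p = i))"
    have ss: "s d * s d = 1"
      unfolding s_def by (simp flip: of_int_mult)
    have "det (\<chi> p i. D $ p $ inv (relabeling g d) i) = of_int (sign (inv (relabeling g d))) * det D"
      using det_permute_columns[OF permutes_inv[OF perm[of d]], of D] by simp
    also have "(\<chi> p i. D $ p $ inv (relabeling g d) i) = (\<chi> p i. s d * of_bool (relabeling g d p = i))"
      by (auto simp: D_def vec_eq_iff permutes_inverses[OF perm] of_bool_def)
    finally have 1: "det (\<chi> p i. s d * of_bool (relabeling g d p = i)) = s d * det D"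
      using sign_inverse[of "relabeling g d"] perm[of d] by (metis s_def permutation_permutes finite)
    have "M d = transpose (\<chi> p i. s d * of_bool (relabeling g d p = i))"
      by (auto simp: M_def transpose_def vec_eq_iff)
    with 1 have "det (M d) = s d * det D" by (simp add: det_transpose)
    also have "det D = (\<Prod>i\<in>UNIV. D $ i $ i)"
      by (rule det_diagonal) (simp add: D_def)
    also have "\<dots> = s d ^ 3" by (simp add: D_def)
    finally show ?thesis by (simp add: ss power3_eq_cube mult.assoc)
  qed
  define z where "z = (\<Prod>d\<in>UNIV. s d)"
  have "z * z = 1"
    unfolding z_def by (simp add: s_def flip: prod.distrib of_int_mult)
  have "tensor M t u = z * of_bool (u = idx_map g t)" for t u
  proof (cases "u = idx_map g t")
    case True
    then show ?thesis using g(2) by (simp add: tensor_def M_def z_def)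
  next
    case False
    then obtain d where "component u d \<noteq> component (idx_map g t) d"
      using idx_eqI by blast
    then have "M d $ component u d $ component t d = 0"
      using g(2) by (simp add: M_def)
    then have "tensor M t u = 0"
      unfolding tensor_def by (intro prod_zero) auto
    with False show ?thesis by simp
  qed
  then have tensor: "tensor M = (\<lambda>t u. z * of_bool (u = idx_map g t))" by blast
  have weight: "weight (tensor M) vs us = z ^ length vs * of_bool (us = map (idx_map g) vs)"
    if "length vs = length us" for vs us
    using that by (induction vs us rule: list_induct2) (auto simp: tensor)
  \<comment> \<open>The degree is even, so the signs cancel.\<close>
  have "z ^ 6 = (z * z) ^ 3" by (simp add: power_mult_distrib flip: power_add)
  then have z6: "z ^ 6 = 1" using \<open>z * z = 1\<close> by simp
  have "T (map (idx_map g) ws) = (\<Sum>vs\<in>words 6. T vs * weight (tensor M) vs (map (idx_map g) ws))"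
    using T ws \<open>\<And>d. det (M d) = 1\<close> by (simp add: invariant_form_def)
  also have "\<dots> = (\<Sum>vs\<in>words 6. if vs = ws then T ws else 0)"
  proof (intro sum.cong refl)
    fix vs assume vs: "vs \<in> words 6"
    have "map (idx_map g) ws = map (idx_map g) vs \<longleftrightarrow> vs = ws"
      using bij_idx_map[OF g(1)] by (auto simp: bij_def inj_map_eq_map)
    with vs ws show "T vs * weight (tensor M) vs (map (idx_map g) ws) = (if vs = ws then T ws else 0)"
      by (simp add: weight words_def z6)
  qed
  also have "\<dots> = T ws"
    using ws by (subst sum.delta[OF finite_words]) (simp add: words_def)
  finally show ?thesis .
qed

lemma det_diagonal_3:
  fixes v :: "3 \<Rightarrow> complex"
  shows "det (\<chi> i j. if i = j then v i else 0) = v 1 * v 2 * v 3"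
  by (subst det_diagonal) (simp_all add: prod_3)

lemma count_list_3: "count_list xs 1 + count_list xs 2 + count_list xs (3::3) = length xs"
proof (induction xs)
  case (Cons x xs)
  then show ?case using exhaust_3[of x] by auto
qed simp

lemma prod_list_indicator:
  fixes a b :: "'a::comm_monoid_mult"
  assumes "p \<noteq> q"
  shows "(\<Prod>x\<leftarrow>xs. if x = p then a else if x = q then b else 1) = a ^ count_list xs p * b ^ count_list xs q"
  using assms by (induction xs) (auto simp: mult_ac)

lemma power_2_inject: "(2::complex) ^ a = 2 ^ b \<Longrightarrow> a = b"
proof -
  assume "(2::complex) ^ a = 2 ^ b"
  then have "(of_nat (2 ^ a) :: complex) = of_nat (2 ^ b)" by simp
  then have "(2::nat) ^ a = 2 ^ b" unfolding of_nat_eq_iff .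
  then show "a = b" by simp
qed

text \<open>
  The torus part of invariance: scaling label \<open>p\<close> by \<open>2\<close> and label \<open>q\<close> by \<open>1 / 2\<close> in direction
  \<open>d\<close> multiplies the value at \<open>us\<close> by a power of two, which must be \<open>1\<close> unless that value is zero.
  So all three labels occur equally often in each direction.
\<close>
lemma invariant_form_balanced:
  assumes T: "invariant_form T" and us: "length us = 6" "T us \<noteq> 0"
  shows "count_list (map (\<lambda>t. component t d) us) x = 2"
proof -
  let ?c = "map (\<lambda>t. component t d) us"
  have eq: "count_list ?c p = count_list ?c q" if pq: "p \<noteq> q" for p q
  proof -
    define v :: "3 \<Rightarrow> complex" where "v x = (if x = p then 2 else if x = q then 1 / 2 else 1)" for x
    define V where "V e = (if e = d then v else (\<lambda>_. 1))" for e
    define M :: "3 \<Rightarrow> complex^3^3" where "M e = (\<chi> i j. if i = j then V e i else 0)" for e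
    have "v 1 * v 2 * v 3 = 1"
      using pq exhaust_3[of p] exhaust_3[of q] by (auto simp: v_def)
    then have det: "\<forall>e. det (M e) = 1"
      by (simp add: M_def det_diagonal_3 V_def)
    have tensor: "tensor M t u = v (component t d) * of_bool (u = t)" for t u
    proof (cases "u = t")
      case True
      have "tensor M t t = (\<Prod>e\<in>UNIV. if e = d then v (component t d) else 1)"
        unfolding tensor_def by (intro prod.cong) (auto simp: M_def V_def)
      with True show ?thesis by simp
    next
      case False
      then obtain e where "component u e \<noteq> component t e" using idx_eqI by blast
      then have "M e $ component u e $ component t e = 0" by (simp add: M_def)
      then have "tensor M t u = 0" unfolding tensor_def by (intro prod_zero) auto
      with False show ?thesis by simp
    qed
    have weight: "weight (tensor M) ws vs = (\<Prod>x\<leftarrow>map (\<lambda>t. component t d) ws. v x) * of_bool (vs = ws)"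
      if "length ws = length vs" for ws vs
      using that by (induction ws vs rule: list_induct2) (auto simp: tensor)
    have "T us = (\<Sum>ws\<in>words 6. T ws * weight (tensor M) ws us)"
      using T us det by (simp add: invariant_form_def)
    also have "\<dots> = (\<Sum>ws\<in>words 6. if ws = us then T us * (\<Prod>x\<leftarrow>?c. v x) else 0)"
      using us by (intro sum.cong) (auto simp: weight words_def)
    also have "\<dots> = T us * (\<Prod>x\<leftarrow>?c. v x)"
      using us by (subst sum.delta[OF finite_words]) (simp add: words_def)
    finally have "(\<Prod>x\<leftarrow>?c. v x) = 1" using us by simp
    also have "(\<Prod>x\<leftarrow>?c. v x) = 2 ^ count_list ?c p * (1 / 2) ^ count_list ?c q"
      unfolding v_def by (rule prod_list_indicator[OF pq])
    finally have "(2::complex) ^ count_list ?c p = 2 ^ count_list ?c q"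
      by (simp add: power_divide field_simps)
    then show ?thesis by (rule power_2_inject)
  qed
  have "count_list ?c x = count_list ?c y" for y
    using eq by (cases "x = y") auto
  from this[of 1] this[of 2] this[of 3] count_list_3[of ?c] us show ?thesis
    by simp
qed

lemma sum_weight_Nil: "(\<Sum>ws\<in>words 0. F ws * weight H ws []) = F []"
proof -
  have "words 0 = {[]}" by (auto simp: words_def)
  then show ?thesis by simp
qed

lemma sum_weight_Cons:
  "(\<Sum>ws\<in>words (Suc n). F ws * weight H ws (u # us)) =
     (\<Sum>t\<in>UNIV. H t u * (\<Sum>ws\<in>words n. F (t # ws) * weight H ws us))"
  by (simp add: sum_words_Suc sum_distrib_left mult_ac)

lemma component_1: "component (i, s) 1 = i"
  by (cases s) simp

text \<open>
  The transvection adding label \<open>1\<close> to label \<open>2\<close> is applied at the word with labels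
  \<open>1, 1, 1, 2, 3, 3\<close>. It relates that value to the values at all words arising by turning some of the
  three labels \<open>1\<close> into \<open>2\<close>; those with two labels \<open>1\<close> left are balanced and survive, the others
  vanish. In terms of pairings of positions with equal labels: the values at the three perfect
  matchings of four points, with the pair of the other two points fixed, sum to zero.
\<close>
lemma exchange_relation:
  assumes T: "invariant_form T"
  shows "T [(2, s1), (1, s2), (1, s3), (2, s4), (3, s5), (3, s6)] +
         T [(1, s1), (2, s2), (1, s3), (2, s4), (3, s5), (3, s6)] +
         T [(1, s1), (1, s2), (2, s3), (2, s4), (3, s5), (3, s6)] = 0"
proof -
  define P :: "complex^3^3" where
    "P = (\<chi> p i. of_bool (p = i) + of_bool (p = 1 \<and> i = 2))"
  define M where "M d = (if d = 1 then P else mat 1)" for d :: 3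
  have "det P = 1" by (simp add: det_3 P_def)
  then have det: "\<forall>d. det (M d) = 1" by (simp add: M_def)
  have tensor: "tensor M (i, s) (p, r) = of_bool (r = s) * (of_bool (p = i) + of_bool (p = 1 \<and> i = 2))" for i s p r
    by (cases s; cases r) (auto simp: tensor_def prod_3 M_def P_def mat_def)
  have sum: "(\<Sum>t\<in>UNIV. tensor M t (p, s) * F t) =
      (if p = 1 then F (1, s) + F (2, s) else F (p, s))" for p s F
  proof -
    have "(\<Sum>t\<in>UNIV. tensor M t (p, s) * F t) = (\<Sum>i\<in>UNIV. \<Sum>r\<in>UNIV. tensor M (i, r) (p, s) * F (i, r))"
      by (simp add: sum.cartesian_product case_prod_unfold)
    also have "\<dots> = (\<Sum>i\<in>UNIV. \<Sum>r\<in>UNIV. if r = s then tensor M (i, s) (p, s) * F (i, s) else 0)"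
      by (intro sum.cong) (auto simp: tensor)
    also have "\<dots> = (\<Sum>i\<in>UNIV. tensor M (i, s) (p, s) * F (i, s))" by simp
    also have "\<dots> = (if p = 1 then F (1, s) + F (2, s) else F (p, s))"
      using exhaust_3[of p] unfolding UNIV_3 by (auto simp: tensor)
    finally show ?thesis .
  qed
  \<comment> \<open>Used to discard five of the eight words that remain after expanding all six positions.\<close>
  have zero: "T us = 0" if "length us = 6" "count_list (map (\<lambda>t. component t 1) us) 1 \<noteq> 2" for us
    using invariant_form_balanced[OF T, of us 1 1] that by blast
  have "words 6 = words (Suc (Suc (Suc (Suc (Suc (Suc 0))))))" by (simp add: eval_nat_numeral)
  then have expand: "T [u1, u2, u3, u4, u5, u6] = (\<Sum>t1\<in>UNIV. tensor M t1 u1 * (\<Sum>t2\<in>UNIV. tensor M t2 u2 * (\<Sum>t3\<in>UNIV. tensor M t3 u3 *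
    (\<Sum>t4\<in>UNIV. tensor M t4 u4 * (\<Sum>t5\<in>UNIV. tensor M t5 u5 * (\<Sum>t6\<in>UNIV. tensor M t6 u6 * T [t1,t2,t3,t4,t5,t6]))))))" for u1 u2 u3 u4 u5 u6
    using T det by (simp add: invariant_form_def sum_weight_Cons sum_weight_Nil del: sum_distrib_left)
  show ?thesis
    using expand[of "(1, s1)" "(1, s2)" "(1, s3)" "(2, s4)" "(3, s5)" "(3, s6)"]
    by (simp add: sum zero component_1 add_ac)
qed

section \<open>Coefficients of orbit sums\<close>
lemma lookup_const_times: "Poly_Mapping.lookup (const c * p) m = c * Poly_Mapping.lookup p m"
proof (induction p rule: cpoly_induct)
  case (add_single n b p)
  then show ?case
    by (simp add: distrib_left lookup_add const_def mult_single lookup_single when_def)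
qed simp

text \<open>
  Each array of an orbit arises from equally many group elements, namely as many as fix \<open>E\<close>: right
  composition with \<open>\<psi>\<close> maps the permutations fixing \<open>E\<close> bijectively to those taking \<open>E\<close> to
  \<open>E \<circ> \<psi>\<close>. The factor in front of an orbit sum therefore turns every nonzero coefficient into \<open>1\<close>.
\<close>
lemma orbit_sum_coefficient:
  "Poly_Mapping.lookup (\<O>\<^sup>+ (monom_of E)) m = (if \<exists>g\<in>G. Poly_Mapping.lookup m = E \<circ> idx_map g then 1 else 0)"
proof -
  define \<Phi> where "\<Phi> = idx_map ` G"
  define F where "F = Poly_Mapping.lookup m"
  define stab where "stab D = {\<phi> \<in> \<Phi>. E \<circ> \<phi> = D}" for D
  have "finite G" unfolding G_def S3_def by simp
  then have fin: "finite \<Phi>" by (simp add: \<Phi>_def)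
  have inj: "inj_on idx_map G" using idx_map_inj by (auto simp: inj_on_def)
  have orbit: "orbit (monom_of E) = monom_of ` (\<lambda>\<phi>. E \<circ> \<phi>) ` \<Phi>"
    by (auto simp: orbit_def G_act_eq \<Phi>_def)
  have card_orbit: "card (orbit (monom_of E)) = card ((\<lambda>\<phi>. E \<circ> \<phi>) ` \<Phi>)"
    unfolding orbit by (rule card_image) (use inj_monom_of in \<open>auto intro: inj_on_subset\<close>)
  have stab: "card (stab (E \<circ> \<psi>)) = card (stab E)" if "\<psi> \<in> \<Phi>" for \<psi>
  proof -
    obtain h where h: "h \<in> G" "\<psi> = idx_map h" using \<open>\<psi> \<in> \<Phi>\<close> by (auto simp: \<Phi>_def)
    obtain k where k: "k \<in> G" "\<And>t. idx_map k (idx_map h t) = t" "\<And>t. idx_map h (idx_map k t) = t"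
      by (rule idx_map_inv[OF h(1)]) blast
    then have k_id: "idx_map k \<circ> idx_map h = id" "idx_map h \<circ> idx_map k = id"
      by (simp_all add: fun_eq_iff)
    have closed: "\<phi> \<circ> idx_map l \<in> \<Phi>" if \<phi>: "\<phi> \<in> \<Phi>" and l: "l \<in> G" for \<phi> l
    proof -
      obtain j where j: "j \<in> G" "\<phi> = idx_map j" using \<phi> by (auto simp: \<Phi>_def)
      show ?thesis
        by (rule idx_map_comp[OF j(1) l]) (auto simp: \<Phi>_def j(2) intro: rev_image_eqI)
    qed
    have "bij_betw (\<lambda>\<phi>. \<phi> \<circ> \<psi>) (stab E) (stab (E \<circ> \<psi>))"
    proof (rule bij_betw_byWitness[where f' = "\<lambda>\<phi>. \<phi> \<circ> idx_map k"])
      show "(\<lambda>\<phi>. \<phi> \<circ> \<psi>) ` stab E \<subseteq> stab (E \<circ> \<psi>)"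
        using closed[OF _ h(1)] by (auto simp: stab_def h(2) o_assoc)
      show "(\<lambda>\<phi>. \<phi> \<circ> idx_map k) ` stab (E \<circ> \<psi>) \<subseteq> stab E"
      proof
        fix \<xi> assume "\<xi> \<in> (\<lambda>\<phi>. \<phi> \<circ> idx_map k) ` stab (E \<circ> \<psi>)"
        then obtain \<phi> where \<phi>: "\<xi> = \<phi> \<circ> idx_map k" "\<phi> \<in> \<Phi>" "E \<circ> \<phi> = E \<circ> \<psi>"
          by (auto simp: stab_def)
        have "E \<circ> \<xi> = E \<circ> \<psi> \<circ> idx_map k" unfolding \<phi>(1) o_assoc \<phi>(3) ..
        also have "\<dots> = E" by (simp add: h(2) k_id flip: o_assoc)
        finally show "\<xi> \<in> stab E" using closed[OF \<phi>(2) k(1)] by (simp add: stab_def \<phi>(1))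
      qed
    qed (auto simp: h(2) k_id simp flip: o_assoc)
    then show ?thesis by (rule bij_betw_same_card[symmetric])
  qed
  have "card \<Phi> = (\<Sum>D\<in>(\<lambda>\<phi>. E \<circ> \<phi>) ` \<Phi>. card (stab D))"
    unfolding stab_def using card_eq_sum sum.image_gen[OF fin, of "\<lambda>_. 1::nat" "\<lambda>\<phi>. E \<circ> \<phi>"] by simp
  also have "\<dots> = card (orbit (monom_of E)) * card (stab E)"
  proof -
    have "(\<Sum>D\<in>(\<lambda>\<phi>. E \<circ> \<phi>) ` \<Phi>. card (stab D)) = (\<Sum>D\<in>(\<lambda>\<phi>. E \<circ> \<phi>) ` \<Phi>. card (stab E))"
      using stab by (intro sum.cong) auto
    then show ?thesis by (simp add: card_orbit)
  qed
  finally have card: "card G = card (orbit (monom_of E)) * card (stab E)"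
    using card_image[OF inj] by (simp add: \<Phi>_def)
  have "id \<in> \<Phi>" unfolding \<Phi>_def using id_in_G by (rule rev_image_eqI[OF _ sym])
  then have "\<Phi> \<noteq> {}" by blast
  then have "card G \<noteq> 0" using fin card_image[OF inj] by (simp add: \<Phi>_def)
  have "Abs_poly_mapping D = m \<longleftrightarrow> D = F" for D
  proof
    show "D = F" if "Abs_poly_mapping D = m"
      unfolding F_def that[symmetric] by simp
  qed (simp add: F_def lookup_inverse)
  then have monom: "Poly_Mapping.lookup (monom_of D) m = (if D = F then 1 else 0)" for D
    by (simp add: monom_of_eq lookup_single when_def)
  have "(\<Sum>g\<in>G. monom_of (G_act g E)) = (\<Sum>\<phi>\<in>\<Phi>. monom_of (E \<circ> \<phi>))"
    unfolding \<Phi>_def by (subst sum.reindex[OF inj]) (simp add: G_act_eq)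
  then have "Poly_Mapping.lookup (\<Sum>g\<in>G. monom_of (G_act g E)) m = (\<Sum>\<phi>\<in>\<Phi>. if E \<circ> \<phi> = F then 1 else 0)"
    by (simp add: lookup_sum monom)
  also have "\<dots> = of_nat (card (stab F))"
    using fin by (simp add: stab_def sum.If_cases Int_def)
  finally have coeff: "Poly_Mapping.lookup (\<O>\<^sup>+ (monom_of E)) m =
      of_nat (card (orbit (monom_of E))) / of_nat (card G) * of_nat (card (stab F))"
    by (simp add: orbit_sum_def lookup_const_times)
  show ?thesis
  proof (cases "\<exists>g\<in>G. F = E \<circ> idx_map g")
    case True
    then have "card (stab F) = card (stab E)" using stab by (auto simp: \<Phi>_def)
    then show ?thesis using True card \<open>card G \<noteq> 0\<close> by (simp add: coeff F_def)
  next
    case False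
    then have "stab F = {}" by (auto simp: stab_def \<Phi>_def)
    then show ?thesis using False by (simp add: coeff F_def)
  qed
qed

text \<open>
  Two words are equivalent if their monomials lie in one orbit; see \<open>orbit_sum_word\<close>.
\<close>
definition equivalent :: "idx list \<Rightarrow> idx list \<Rightarrow> bool" where
  "equivalent ws vs \<longleftrightarrow> (\<exists>g\<in>G. mset ws = mset (map (idx_map g) vs))"

lemma equivalent_refl: "mset ws = mset vs \<Longrightarrow> equivalent ws vs"
  unfolding equivalent_def using id_in_G by (intro bexI[of _ "((id, id, id), id)"]) auto

lemma equivalent_map: "g \<in> G \<Longrightarrow> equivalent (map (idx_map g) ws) ws"
  unfolding equivalent_def by blast

lemma equivalent_sym:
  assumes "equivalent ws vs"
  shows "equivalent vs ws"
proof -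
  obtain g where g: "g \<in> G" "mset ws = mset (map (idx_map g) vs)"
    using assms by (auto simp: equivalent_def)
  obtain k where k: "k \<in> G" "\<And>t. idx_map k (idx_map g t) = t"
    by (rule idx_map_inv[OF g(1)]) blast
  have "mset (map (idx_map k) ws) = image_mset (idx_map k) (mset (map (idx_map g) vs))"
    by (simp add: g(2))
  also have "\<dots> = mset vs" by (simp add: k(2) multiset.map_comp o_def)
  finally show ?thesis using k(1) unfolding equivalent_def by metis
qed

lemma equivalent_trans [trans]:
  assumes "equivalent ws vs" "equivalent vs us"
  shows "equivalent ws us"
proof -
  obtain g where g: "g \<in> G" "mset ws = mset (map (idx_map g) vs)"
    using assms by (auto simp: equivalent_def)
  obtain h where h: "h \<in> G" "mset vs = mset (map (idx_map h) us)"
    using assms by (auto simp: equivalent_def)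
  obtain k where k: "k \<in> G" "idx_map k = idx_map g \<circ> idx_map h"
    by (rule idx_map_comp[OF g(1) h(1)])
  have "mset ws = mset (map (idx_map k) us)"
    by (simp add: g(2) h(2) k(2) multiset.map_comp)
  then show ?thesis using k(1) unfolding equivalent_def by blast
qed

lemma monom_of_count: "monom_of (count (mset vs)) = Poly_Mapping.single (exponent_of vs) 1"
proof -
  have "count (mset vs) = Poly_Mapping.lookup (exponent_of vs)" by (simp add: lookup_exponent_of fun_eq_iff)
  then show ?thesis by (simp add: monom_of_eq lookup_inverse)
qed

lemma count_image_inj: "inj f \<Longrightarrow> count (image_mset f M) (f x) = count M x"
  by (induction M) (auto simp: inj_eq)

lemma orbit_sum_word:
  "Poly_Mapping.lookup (\<O>\<^sup>+ (Poly_Mapping.single (exponent_of vs) 1)) (exponent_of ws) = of_bool (equivalent ws vs)"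
proof -
  have "(\<exists>g\<in>G. Poly_Mapping.lookup (exponent_of ws) = count (mset vs) \<circ> idx_map g) \<longleftrightarrow> equivalent vs ws"
    unfolding equivalent_def
  proof (intro bex_cong refl)
    fix g assume g: "g \<in> G"
    have inj: "inj (idx_map g)" and surj: "surj (idx_map g)"
      using bij_idx_map[OF g] by (auto simp: bij_def)
    have "Poly_Mapping.lookup (exponent_of ws) = count (mset vs) \<circ> idx_map g \<longleftrightarrow>
      (\<forall>t. count (image_mset (idx_map g) (mset ws)) (idx_map g t) = count (mset vs) (idx_map g t))"
      by (simp add: fun_eq_iff lookup_exponent_of count_image_inj[OF inj])
    also have "\<dots> \<longleftrightarrow> mset vs = mset (map (idx_map g) ws)"
      using surj by (metis mset_map multiset_eqI surjD)
    finally show "Poly_Mapping.lookup (exponent_of ws) = count (mset vs) \<circ> idx_map g \<longleftrightarrow>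
        mset vs = mset (map (idx_map g) ws)" .
  qed
  then show ?thesis
    using equivalent_sym by (auto simp: orbit_sum_coefficient simp flip: monom_of_count)
qed

lemma rearrangements_equivalent:
  assumes "equivalent ws vs"
  shows "rearrangements ws = rearrangements vs"
proof -
  obtain g where g: "g \<in> G" "mset ws = mset (map (idx_map g) vs)"
    using assms by (auto simp: equivalent_def)
  then have inj: "inj (idx_map g)" using bij_idx_map bij_is_inj by blast
  have "permutations_of_multiset (mset ws) = map (idx_map g) ` permutations_of_multiset (mset vs)"
    using g(2) permutations_of_multiset_image[of "idx_map g" "mset vs"] inj by (simp add: inj_on_subset)
  moreover have "inj_on (map (idx_map g)) (permutations_of_multiset (mset vs))"
    using inj by (auto intro: inj_on_subset)
  ultimately show ?thesis by (simp add: rearrangements_def card_image)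
qed

section \<open>An invariant that separates the orbits\<close>
definition share :: "idx \<Rightarrow> idx \<Rightarrow> nat" where
  "share s t = (\<Sum>d\<in>UNIV. of_bool (component s d = component t d))"

text \<open>
  If \<open>n s t\<close> counts common indices, the matrix of these numbers over the positions of a word is the
  sum of the three adjacency matrices recording equal labels in one direction. The trace of its cube
  depends only on the orbit and takes different values on the eight orbits that occur. The trace of
  the square would not suffice: it does not tell \<open>rep1\<close> from \<open>rep8\<close>.
\<close>
definition gram_cube_trace :: "('a \<Rightarrow> 'a \<Rightarrow> nat) \<Rightarrow> 'a list \<Rightarrow> nat" where
  "gram_cube_trace n ws = (\<Sum>s\<leftarrow>ws. \<Sum>t\<leftarrow>ws. n s t * (\<Sum>u\<leftarrow>ws. n t u * n u s))"

lemma gram_cube_trace_map: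
  "gram_cube_trace n (map f ws) = gram_cube_trace (\<lambda>s t. n (f s) (f t)) ws"
  by (simp add: gram_cube_trace_def o_def)

lemma gram_cube_trace_mset:
  assumes "mset ws = mset vs"
  shows "gram_cube_trace n ws = gram_cube_trace n vs"
proof -
  have sum: "(\<Sum>x\<leftarrow>xs. f x) = (\<Sum>x\<in>#mset xs. f x)" for f :: "'a \<Rightarrow> nat" and xs
    by (metis mset_map sum_mset_sum_list)
  show ?thesis unfolding gram_cube_trace_def sum assms ..
qed

lemma share_idx_map:
  assumes "g \<in> G"
  shows "share (idx_map g s) (idx_map g t) = share s t"
proof -
  have inj: "relabeling g d x = relabeling g d y \<longleftrightarrow> x = y" for d x y
    using assms by (meson G_iff injD permutes_inj)
  have "share (idx_map g s) (idx_map g t) =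
      (\<Sum>d\<in>UNIV. of_bool (component s (snd g d) = component t (snd g d)))"
    by (simp add: share_def inj)
  also have "\<dots> = share s t"
    unfolding share_def using assms
    by (intro sum.permute[symmetric, unfolded o_def]) (simp add: G_iff)
  finally show ?thesis .
qed

lemma gram_cube_trace_equivalent:
  assumes "equivalent ws vs"
  shows "gram_cube_trace share ws = gram_cube_trace share vs"
proof -
  obtain g where g: "g \<in> G" "mset ws = mset (map (idx_map g) vs)"
    using assms by (auto simp: equivalent_def)
  have "gram_cube_trace share ws = gram_cube_trace share (map (idx_map g) vs)"
    by (rule gram_cube_trace_mset[OF g(2)])
  then show ?thesis by (simp add: gram_cube_trace_map share_idx_map[OF g(1)])
qed

section \<open>Words in three letters and decidable equivalence\<close>
text \<open>
  The remaining facts about words are finite checks by rewriting. These are carried out on triples of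
  letters, whose equality is decided by pattern matching, and transported to index triples along
  \<open>cell_idx\<close>.
\<close>
datatype letter = A | B | C

type_synonym cell = "letter \<times> letter \<times> letter"

text \<open>
  A cell is also read as the function from letters to letters with these three values; the six
  bijective ones are listed in \<open>perms\<close> below and serve both to relabel and to permute directions.
\<close>
fun entry :: "cell \<Rightarrow> letter \<Rightarrow> letter" where
  "entry (p, q, r) A = p"
| "entry (p, q, r) B = q"
| "entry (p, q, r) C = r"

fun index :: "letter \<Rightarrow> 3" where
  "index A = 1" | "index B = 2" | "index C = 3"

fun cell_idx :: "cell \<Rightarrow> idx" where
  "cell_idx (x, y, z) = (index x, index y, index z)"

lemma ex_index: "\<exists>x. index x = i"
  using exhaust_3[of i] by (metis index.simps)

lemma index_inj [simp]: "index x = index y \<longleftrightarrow> x = y"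
  by (cases x; cases y) auto

lemma component_cell_idx: "component (cell_idx t) (index s) = index (entry t s)"
  by (cases t; cases s) auto

lemma cell_idx_surj: "\<exists>t. cell_idx t = i"
  by (cases i) (metis cell_idx.simps ex_index)

lemma cell_idx_eqI: "(\<And>s. component u (index s) = index (entry t s)) \<Longrightarrow> u = cell_idx t"
  by (rule idx_eqI) (metis component_cell_idx ex_index)

definition perms :: "cell list" where
  "perms = [(A, B, C), (A, C, B), (B, A, C), (B, C, A), (C, A, B), (C, B, A)]"

definition index_perm :: "cell \<Rightarrow> 3 \<Rightarrow> 3" where
  "index_perm p i = index (entry p (inv index i))"

lemma index_perm [simp]: "index_perm p (index x) = index (entry p x)"
  by (simp add: index_perm_def inv_f_f inj_def)

lemma index_perm_permutes: "p \<in> set perms \<Longrightarrow> index_perm p permutes UNIV"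
proof -
  assume "p \<in> set perms"
  then have "entry p x = entry p y \<longleftrightarrow> x = y" for x y
    by (cases x; cases y) (auto simp: perms_def)
  then have "inj (index_perm p)"
    by (intro injI) (metis ex_index index_inj index_perm)
  then have "bij (index_perm p)"
    by (simp add: bij_def finite_UNIV_inj_surj)
  then show ?thesis by (intro bij_imp_permutes) simp_all
qed

fun relabel :: "cell \<Rightarrow> cell \<Rightarrow> cell \<Rightarrow> cell \<Rightarrow> cell" where
  "relabel a b c (x, y, z) = (entry a x, entry b y, entry c z)"

fun permute_slots :: "cell \<Rightarrow> cell \<Rightarrow> cell" where
  "permute_slots (p, q, r) t = (entry t p, entry t q, entry t r)"

lemma relabel_idx_map:
  assumes "a \<in> set perms" "b \<in> set perms" "c \<in> set perms"
  obtains g where "g \<in> G" "snd g = id" "\<And>t. cell_idx (relabel a b c t) = idx_map g (cell_idx t)"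
proof
  let ?g = "((index_perm a, index_perm b, index_perm c), id)"
  show "?g \<in> G"
    using assms index_perm_permutes by (simp add: G_iff permutes_id forall_3)
  show "cell_idx (relabel a b c t) = idx_map ?g (cell_idx t)" for t
  proof (rule cell_idx_eqI[symmetric])
    show "component (idx_map ?g (cell_idx t)) (index s) = index (entry (relabel a b c t) s)" for s
      by (cases t; cases s) (simp_all add: component_cell_idx)
  qed
qed simp

lemma slots_idx_map:
  assumes "d \<in> set perms"
  obtains g where "g \<in> G" "\<And>t. cell_idx (permute_slots d t) = idx_map g (cell_idx t)"
proof
  let ?g = "((id, id, id), index_perm d)"
  show "?g \<in> G"
    using assms index_perm_permutes by (simp add: G_iff permutes_id forall_3)
  show "cell_idx (permute_slots d t) = idx_map ?g (cell_idx t)" for t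
  proof (rule cell_idx_eqI[symmetric])
    have slot: "entry (permute_slots d t) s = entry t (entry d s)" for s
      by (cases d; cases s) simp_all
    have "relabeling ?g e = id" for e by simp
    then show "component (idx_map ?g (cell_idx t)) (index s) = index (entry (permute_slots d t) s)" for s
      unfolding component_idx_map slot by (simp add: component_cell_idx)
  qed
qed

abbreviation cells_idx :: "cell list \<Rightarrow> idx list" where
  "cells_idx \<equiv> map cell_idx"

lemma equivalent_relabel:
  assumes "a \<in> set perms" "b \<in> set perms" "c \<in> set perms"
  shows "equivalent (cells_idx (map (relabel a b c) w)) (cells_idx w)"
proof -
  obtain g where "g \<in> G" "\<And>t. cell_idx (relabel a b c t) = idx_map g (cell_idx t)"
    using relabel_idx_map[OF assms] by metis
  then show ?thesis using equivalent_map[of g "cells_idx w"] by (simp add: o_def)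
qed

lemma equivalent_slots:
  assumes "d \<in> set perms"
  shows "equivalent (cells_idx (map (permute_slots d) w)) (cells_idx w)"
proof -
  obtain g where "g \<in> G" "\<And>t. cell_idx (permute_slots d t) = idx_map g (cell_idx t)"
    using slots_idx_map[OF assms] by metis
  then show ?thesis using equivalent_map[of g "cells_idx w"] by (simp add: o_def)
qed

text \<open>
  Bounded search by \<open>if\<close>, so that rewriting does not evaluate the remaining candidates after a hit.
  The same holds for a failing comparison in \<open>rearranged\<close>.
\<close>
fun found :: "('a \<Rightarrow> bool) \<Rightarrow> 'a list \<Rightarrow> bool" where
  "found P [] = False"
| "found P (x # xs) = (if P x then True else found P xs)"

lemma found_iff: "found P xs \<longleftrightarrow> (\<exists>x\<in>set xs. P x)"
  by (induction xs) auto

fun rearranged :: "'a list \<Rightarrow> 'a list \<Rightarrow> bool" where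
  "rearranged [] ys = (ys = [])"
| "rearranged (x # xs) ys = (if x \<in> set ys then rearranged xs (remove1 x ys) else False)"

lemma rearranged_iff: "rearranged xs ys \<longleftrightarrow> mset xs = mset ys"
proof (induction xs arbitrary: ys)
  case (Cons x xs)
  have "add_mset x (mset xs) = mset ys \<longleftrightarrow> x \<in> set ys \<and> mset xs = mset ys - {#x#}"
    by (metis add_mset_remove_trivial insert_DiffM set_mset_mset union_single_eq_member)
  with Cons show ?case by simp
qed simp

fun first_two :: "cell \<Rightarrow> letter \<times> letter" where
  "first_two (x, y, z) = (x, y)"

fun relabel_pair :: "cell \<Rightarrow> cell \<Rightarrow> letter \<times> letter \<Rightarrow> letter \<times> letter" where
  "relabel_pair a b (x, y) = (entry a x, entry b y)"

text \<open>
  A search through all 1296 symmetries. The first two directions are compared before the relabeling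
  of the third is enumerated, which discards most candidates early.
\<close>
definition same_orbit :: "cell list \<Rightarrow> cell list \<Rightarrow> bool" where
  "same_orbit w v \<longleftrightarrow> found (\<lambda>d.
     let w' = map (permute_slots d) w; p = map first_two w'; q = map first_two v in
     found (\<lambda>a. found (\<lambda>b.
       if rearranged (map (relabel_pair a b) q) p
       then found (\<lambda>c. rearranged (map (relabel a b c) v) w') perms
       else False) perms) perms) perms"

lemma same_orbit_equivalent:
  assumes "same_orbit w v"
  shows "equivalent (cells_idx w) (cells_idx v)"
proof -
  obtain a b c d where perms: "a \<in> set perms" "b \<in> set perms" "c \<in> set perms" "d \<in> set perms"
    and eq: "mset (map (relabel a b c) v) = mset (map (permute_slots d) w)"
    using assms by (auto simp: same_orbit_def Let_def found_iff rearranged_iff split: if_splits)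
  have "equivalent (cells_idx w) (cells_idx (map (permute_slots d) w))"
    using equivalent_slots[OF perms(4)] by (rule equivalent_sym)
  also have "equivalent \<dots> (cells_idx (map (relabel a b c) v))"
    using arg_cong[OF eq, of "image_mset cell_idx"] by (intro equivalent_refl) (simp add: multiset.map_comp)
  also have "equivalent \<dots> (cells_idx v)"
    by (rule equivalent_relabel[OF perms(1-3)])
  finally show ?thesis .
qed

definition same_relabeled :: "cell list \<Rightarrow> cell list \<Rightarrow> bool" where
  "same_relabeled w v \<longleftrightarrow> found (\<lambda>a. found (\<lambda>b. found (\<lambda>c.
      rearranged (map (relabel a b c) v) w) perms) perms) perms"

lemma same_relabeled_eq:
  assumes T: "invariant_form T" and w: "same_relabeled w v" "length v = 6"
  shows "T (cells_idx w) = T (cells_idx v)"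
proof -
  obtain a b c where perms: "a \<in> set perms" "b \<in> set perms" "c \<in> set perms"
    and eq: "mset (map (relabel a b c) v) = mset w"
    using w by (auto simp: same_relabeled_def found_iff rearranged_iff)
  obtain g where g: "g \<in> G" "snd g = id" "\<And>t. cell_idx (relabel a b c t) = idx_map g (cell_idx t)"
    using relabel_idx_map[OF perms] by metis
  have "mset (cells_idx w) = mset (map (idx_map g) (cells_idx v))"
    using arg_cong[OF eq, of "image_mset cell_idx"] by (simp add: g(3) multiset.map_comp o_def)
  then have "T (cells_idx w) = T (map (idx_map g) (cells_idx v))"
    using T unfolding invariant_form_def symmetric_form_def by blast
  also have "\<dots> = T (cells_idx v)"
    using w(2) by (intro invariant_form_relabel[OF T g(1,2)]) simp
  finally show ?thesis .
qed

section \<open>The value of an invariant form on each orbit\<close>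
definition diagonal :: "cell list" where
  "diagonal = [(A, A, A), (A, A, A), (B, B, B), (B, B, B), (C, C, C), (C, C, C)]"

text \<open>
  On triples \<open>(i, i, i)\<close> permuting directions does nothing, so every symmetry acts on this word as
  a mere relabeling.
\<close>
lemma diagonal_invariant:
  assumes T: "invariant_form T" and g: "g \<in> G"
  shows "T (map (idx_map g) (cells_idx diagonal)) = T (cells_idx diagonal)"
proof -
  obtain h where h: "\<And>d. relabeling h d = relabeling g (snd g d)" "snd h = id"
    using ex_sym[of "\<lambda>d. relabeling g (snd g d)" id] by blast
  then have "h \<in> G" using g by (simp add: G_iff permutes_id)
  have "idx_map g (i, i, i) = idx_map h (i, i, i)" for i
  proof (rule idx_eqI)
    have "component (i, i, i) e = i" for e by simp
    then show "component (idx_map g (i, i, i)) d = component (idx_map h (i, i, i)) d" for d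
      unfolding component_idx_map by (simp only: h id_apply)
  qed
  then have "map (idx_map g) (cells_idx diagonal) = map (idx_map h) (cells_idx diagonal)"
    by (simp add: diagonal_def)
  then show ?thesis
    using invariant_form_relabel[OF T \<open>h \<in> G\<close> h(2), of "cells_idx diagonal"] by (simp add: diagonal_def)
qed

text \<open>
  Quantifying over all invariant forms makes this a property of the orbit of \<open>w\<close>, because composing
  with a symmetry gives another invariant form with the same value at the diagonal word.
\<close>
definition ratio :: "cell list \<Rightarrow> complex \<Rightarrow> bool" where
  "ratio w r \<longleftrightarrow> (\<forall>T. invariant_form T \<longrightarrow> T (cells_idx w) = r * T (cells_idx diagonal))"

lemma ratio_equivalent:
  assumes T: "invariant_form T" and v: "ratio v r" and eq: "equivalent ws (cells_idx v)"
  shows "T ws = r * T (cells_idx diagonal)"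
proof -
  obtain g where g: "g \<in> G" "mset ws = mset (map (idx_map g) (cells_idx v))"
    using eq by (auto simp: equivalent_def)
  have "T ws = T (map (idx_map g) (cells_idx v))"
    using T g(2) unfolding invariant_form_def symmetric_form_def by blast
  also have "\<dots> = r * T (map (idx_map g) (cells_idx diagonal))"
    using v invariant_form_idx_map[OF T g(1)] unfolding ratio_def by blast
  finally show ?thesis unfolding diagonal_invariant[OF T g(1)] .
qed

lemma ratio_same_orbit: "ratio v r \<Longrightarrow> same_orbit w v \<Longrightarrow> ratio w r"
  unfolding ratio_def[of w] using ratio_equivalent same_orbit_equivalent by blast

lemma ratio_diagonal: "ratio diagonal 1"
  by (simp add: ratio_def)

lemma exchange_cells:
  assumes "invariant_form T" "length s = 6"
  shows "T (cells_idx (zip [B, A, A, B, C, C] s)) + T (cells_idx (zip [A, B, A, B, C, C] s)) +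
    T (cells_idx (zip [A, A, B, B, C, C] s)) = 0"
proof -
  define J where "J = (\<lambda>(y, z). (index y, index z))"
  have J: "cell_idx (x, p) = (index x, J p)" for x p by (cases p) (simp add: J_def)
  obtain s1 s2 s3 s4 s5 s6 where "s = [s1, s2, s3, s4, s5, s6]"
    using assms(2) by (auto simp: eval_nat_numeral length_Suc_conv)
  then show ?thesis using exchange_relation[OF assms(1)] by (simp add: J)
qed

lemma ratio_exchange:
  assumes "length s = 6" "ratio v r" "same_orbit (zip [B, A, A, B, C, C] s) v"
    "ratio v' r'" "same_orbit (zip [A, B, A, B, C, C] s) v'"
  shows "ratio (zip [A, A, B, B, C, C] s) (- r - r')"
proof -
  have 1: "ratio (zip [B, A, A, B, C, C] s) r" "ratio (zip [A, B, A, B, C, C] s) r'"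
    using assms ratio_same_orbit by blast+
  show ?thesis unfolding ratio_def
  proof (intro allI impI)
    fix T assume T: "invariant_form T"
    show "T (cells_idx (zip [A, A, B, B, C, C] s)) = (- r - r') * T (cells_idx diagonal)"
      using exchange_cells[OF T assms(1)] 1 T
      by (simp add: ratio_def algebra_simps eq_neg_iff_add_eq_0 del: zip_Cons_Cons list.map)
  qed
qed

text \<open>
  When two of the three words of an exchange relation differ by a relabeling only, they have the same
  value, and the third word determines it.
\<close>
lemma ratio_exchange_symmetric:
  assumes "length s = 6" "ratio v r" "same_orbit (zip [B, A, A, B, C, C] s) v"
    "same_relabeled (zip [A, B, A, B, C, C] s) (zip [A, A, B, B, C, C] s)"
  shows "ratio (zip [A, A, B, B, C, C] s) (- r / 2)"
proof -
  have 1: "ratio (zip [B, A, A, B, C, C] s) r"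
    using assms ratio_same_orbit by blast
  show ?thesis unfolding ratio_def
  proof (intro allI impI)
    fix T assume T: "invariant_form T"
    have "T (cells_idx (zip [A, B, A, B, C, C] s)) = T (cells_idx (zip [A, A, B, B, C, C] s))"
      using assms by (intro same_relabeled_eq[OF T]) simp_all
    moreover have "T (cells_idx (zip [B, A, A, B, C, C] s)) = r * T (cells_idx diagonal)"
      using 1 T unfolding ratio_def by blast
    ultimately show "T (cells_idx (zip [A, A, B, B, C, C] s)) = (- r / 2) * T (cells_idx diagonal)"
      using exchange_cells[OF T assms(1)]
      by (simp add: field_simps eq_neg_iff_add_eq_0 del: zip_Cons_Cons list.map)
  qed
qed

text \<open>
  One word for each nontrivial orbit, in an order in which each is the last word of an exchange
  relation whose other words are already known or are relabelings of it. Since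
  \<open>ratio_exchange\<close> and \<open>ratio_exchange_symmetric\<close> act in the first direction, the words are written
  with first letters \<open>A, A, B, B, C, C\<close>.
\<close>
definition step1 :: "cell list" where
  "step1 = zip [A, A, B, B, C, C] [(A,A), (B,B), (B,B), (A,A), (C,C), (C,C)]"
definition step2 :: "cell list" where
  "step2 = zip [A, A, B, B, C, C] [(A,A), (B,B), (B,B), (C,C), (A,A), (C,C)]"
definition step3 :: "cell list" where
  "step3 = zip [A, A, B, B, C, C] [(A,A), (B,B), (B,B), (A,C), (C,A), (C,C)]"
definition step4 :: "cell list" where
  "step4 = zip [A, A, B, B, C, C] [(A,A), (B,B), (B,A), (A,B), (C,C), (C,C)]"
definition step5 :: "cell list" where
  "step5 = zip [A, A, B, B, C, C] [(A,A), (B,B), (B,B), (C,C), (A,C), (C,A)]"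
definition step6 :: "cell list" where
  "step6 = zip [A, A, B, B, C, C] [(A,A), (B,B), (B,A), (C,C), (A,C), (C,B)]"
definition step7 :: "cell list" where
  "step7 = zip [A, A, B, B, C, C] [(A,A), (B,B), (B,C), (C,A), (A,C), (C,B)]"

lemma ratio_step1: "ratio step1 (- 1 / 2)"
  unfolding step1_def
  by (rule ratio_exchange_symmetric[OF _ ratio_diagonal]) (simp, code_simp, code_simp)

lemma ratio_step2: "ratio step2 (1 / 4)"
proof -
  have "ratio step2 (- (- 1 / 2) / 2)" unfolding step2_def
    by (rule ratio_exchange_symmetric[OF _ ratio_step1]) (simp, code_simp, code_simp)
  then show ?thesis by simp
qed

lemma ratio_step3: "ratio step3 (1 / 4)"
proof -
  have "ratio step3 (- (- 1 / 2) / 2)" unfolding step3_def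
    by (rule ratio_exchange_symmetric[OF _ ratio_step1]) (simp, code_simp, code_simp)
  then show ?thesis by simp
qed

lemma ratio_step4: "ratio step4 1"
proof -
  have "ratio step4 (- (- 1 / 2) - (- 1 / 2))" unfolding step4_def
    by (rule ratio_exchange[OF _ ratio_step1 _ ratio_step1]) (simp, code_simp, code_simp)
  then show ?thesis by simp
qed

lemma ratio_step5: "ratio step5 (- 1 / 2)"
  unfolding step5_def
  by (rule ratio_exchange_symmetric[OF _ ratio_step4]) (simp, code_simp, code_simp)

lemma ratio_step6: "ratio step6 1"
proof -
  have "ratio step6 (- (- 1 / 2) - (- 1 / 2))" unfolding step6_def
    by (rule ratio_exchange[OF _ ratio_step5 _ ratio_step5]) (simp, code_simp, code_simp)
  then show ?thesis by simp
qed

lemma ratio_step7: "ratio step7 (- 5 / 4)"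
proof -
  have "ratio step7 (- (1 / 4) - 1)" unfolding step7_def
    by (rule ratio_exchange[OF _ ratio_step3 _ ratio_step6]) (simp, code_simp, code_simp)
  then show ?thesis by simp
qed

text \<open>
  The words of the eight monomials in the theorem, in the same order, with \<open>A, B, C\<close> for
  \<open>1, 2, 3\<close>.
\<close>
definition rep1 :: "cell list" where
  "rep1 = [(A,B,C),(A,C,B),(B,A,C),(B,C,A),(C,A,B),(C,B,A)]"
definition rep2 :: "cell list" where
  "rep2 = [(A,C,B),(A,C,C),(B,A,C),(B,B,A),(C,A,A),(C,B,B)]"
definition rep3 :: "cell list" where
  "rep3 = [(A,C,C),(A,C,C),(B,B,A),(B,B,B),(C,A,A),(C,A,B)]"
definition rep4 :: "cell list" where
  "rep4 = [(A,C,C),(A,C,C),(B,B,B),(B,B,B),(C,A,A),(C,A,A)]"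
definition rep5 :: "cell list" where
  "rep5 = [(A,C,B),(A,C,C),(B,B,A),(B,B,C),(C,A,A),(C,A,B)]"
definition rep6 :: "cell list" where
  "rep6 = [(A,C,B),(A,C,C),(B,A,C),(B,B,B),(C,A,A),(C,B,A)]"
definition rep7 :: "cell list" where
  "rep7 = [(A,C,C),(A,C,C),(B,A,B),(B,B,A),(C,A,A),(C,B,B)]"
definition rep8 :: "cell list" where
  "rep8 = [(A,B,C),(A,C,B),(B,A,C),(B,C,A),(C,A,A),(C,B,B)]"

lemmas rep_defs = rep1_def rep2_def rep3_def rep4_def rep5_def rep6_def rep7_def rep8_def

lemma rep_ratios:
  "ratio rep1 (- 5 / 4)" "ratio rep2 (- 1 / 2)" "ratio rep3 (- 1 / 2)" "ratio rep4 1"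
  "ratio rep5 (1 / 4)" "ratio rep6 (1 / 4)" "ratio rep7 1" "ratio rep8 1"
  by (rule ratio_same_orbit[OF ratio_step7], code_simp,
      rule ratio_same_orbit[OF ratio_step5], code_simp,
      rule ratio_same_orbit[OF ratio_step1], code_simp,
      rule ratio_same_orbit[OF ratio_diagonal], code_simp,
      rule ratio_same_orbit[OF ratio_step2], code_simp,
      rule ratio_same_orbit[OF ratio_step3], code_simp,
      rule ratio_same_orbit[OF ratio_step4], code_simp,
      rule ratio_same_orbit[OF ratio_step6], code_simp)

fun share_cells :: "cell \<Rightarrow> cell \<Rightarrow> nat" where
  "share_cells (x, y, z) (x', y', z') = of_bool (x = x') + of_bool (y = y') + of_bool (z = z')"

lemma share_cell_idx: "share (cell_idx s) (cell_idx t) = share_cells s t"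
  by (cases s; cases t) (simp add: share_def sum_3)

lemma trace_cells: "gram_cube_trace share (cells_idx w) = gram_cube_trace share_cells w"
  by (simp add: gram_cube_trace_map share_cell_idx)

lemma traces:
  "map (gram_cube_trace share_cells) [rep1, rep2, rep3, rep4, rep5, rep6, rep7, rep8] = [324, 372, 504, 648, 432, 396, 456, 336]"
  by code_simp

section \<open>Classification of balanced words\<close>
text \<open>
  Reordering the images under a projection is realised by reordering the word, whatever its other
  components are. This allows the directions to be normalised one after the other.
\<close>
lemma lift_rearrangement:
  assumes "mset (map f w) = mset p"
  obtains w' where "mset w' = mset w" "map f w' = p"
proof -
  obtain \<pi> where \<pi>: "\<pi> permutes {..<length (map f w)}" "permute_list \<pi> (map f w) = p"
    using mset_eq_permutation[OF assms[symmetric]] by metis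
  then have "map f (permute_list \<pi> w) = p" "mset (permute_list \<pi> w) = mset w"
    by (simp_all add: permute_list_map)
  then show ?thesis by (rule that[rotated])
qed

abbreviation aabbcc :: "letter list" where "aabbcc \<equiv> [A, A, B, B, C, C]"

text \<open>
  The fifteen perfect matchings of six points, each written as the word that labels its pairs in the
  order of their first points.
\<close>
definition normal_words :: "letter list list" where
  "normal_words = [
    [A, A, B, B, C, C], [A, A, B, C, B, C], [A, A, B, C, C, B],
    [A, B, A, B, C, C], [A, B, A, C, B, C], [A, B, A, C, C, B],
    [A, B, B, A, C, C], [A, B, C, A, B, C], [A, B, C, A, C, B],
    [A, B, B, C, A, C], [A, B, C, B, A, C], [A, B, C, C, A, B],
    [A, B, B, C, C, A], [A, B, C, B, C, A], [A, B, C, C, B, A]]"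

lemma normal_word_check:
  "list_all (\<lambda>b. if rearranged b aabbcc then found (\<lambda>a. map (entry a) b \<in> set normal_words) perms else True)
     (List.n_lists 6 [A, B, C])"
  by code_simp

lemma normal_word:
  assumes "mset b = mset aabbcc"
  obtains a where "a \<in> set perms" "map (entry a) b \<in> set normal_words"
proof -
  have "x \<in> {A, B, C}" for x by (cases x) auto
  then have "b \<in> set (List.n_lists 6 [A, B, C])"
    using mset_eq_length[OF assms] by (auto simp: set_n_lists)
  then have "found (\<lambda>a. map (entry a) b \<in> set normal_words) perms"
    using normal_word_check assms by (fastforce simp: list_all_iff rearranged_iff)
  then show ?thesis using that unfolding found_iff by blast
qed

text \<open>
  Two perfect matchings of six points form a union of even cycles, of total length six: three double
  edges, a double edge and a square, or a hexagon. These are words for the three types.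
\<close>
definition pair_words :: "(letter \<times> letter) list list" where
  "pair_words = map (zip aabbcc) [[A, A, B, B, C, C], [A, A, B, C, B, C], [A, B, A, C, B, C]]"

lemma pair_word_check:
  "list_all (\<lambda>b. found (\<lambda>a. found (\<lambda>c. found (\<lambda>p. rearranged (map (relabel_pair a c) (zip aabbcc b)) p)
     pair_words) perms) perms) normal_words"
  by code_simp

text \<open>
  Comparing traces first avoids searching for a symmetry in the orbits where there is none.
\<close>
lemma triple_word_check:
  "list_all (\<lambda>p. list_all (\<lambda>c. let w = map2 (\<lambda>(x, y) z. (x, y, z)) p c; n = gram_cube_trace share_cells w in
     found (\<lambda>v. if n = gram_cube_trace share_cells v then same_orbit w v else False)
       [rep1, rep2, rep3, rep4, rep5, rep6, rep7, rep8]) normal_words) pair_words"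
  by code_simp

lemma entry_relabel [simp]:
  "entry (relabel a b c t) A = entry a (entry t A)"
  "entry (relabel a b c t) B = entry b (entry t B)"
  "entry (relabel a b c t) C = entry c (entry t C)"
  by (cases t; simp)+

lemma entry_id [simp]: "entry (A, B, C) x = x"
  by (cases x) simp_all

lemma first_two_relabel [simp]: "first_two (relabel a b c t) = relabel_pair a b (first_two t)"
  by (cases t) simp

lemma first_two_zip: "map first_two w = zip (map (\<lambda>t. entry t A) w) (map (\<lambda>t. entry t B) w)"
  by (induction w) auto

lemma word_from_pairs:
  "w = map2 (\<lambda>(x, y) z. (x, y, z)) (map first_two w) (map (\<lambda>t. entry t C) w)"
  by (induction w) auto

lemma id_in_perms [simp]: "(A, B, C) \<in> set perms"
  by (simp add: perms_def)

text \<open>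
  The first direction is brought to the form \<open>A, A, B, B, C, C\<close> by reordering, the first two
  directions to one of the three types of pairs of matchings, and the third direction to one of fifteen
  matchings by relabeling. The remaining 45 words are checked individually.
\<close>
lemma classification:
  assumes balanced: "\<And>s. mset (map (\<lambda>t. entry t s) w) = mset aabbcc"
  obtains v where "v \<in> set [rep1, rep2, rep3, rep4, rep5, rep6, rep7, rep8]" "equivalent (cells_idx w) (cells_idx v)"
proof -
  have rearr: "equivalent (cells_idx w') (cells_idx w'')" if "mset w' = mset w''" for w' w''
    using that by (intro equivalent_refl) simp
  have count: "mset (map f w') = mset (map f w'')" if "mset w' = mset w''" for f :: "cell \<Rightarrow> letter" and w' w''
    using that by simp
  obtain w1 where w1: "mset w1 = mset w" "map (\<lambda>t. entry t A) w1 = aabbcc"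
    by (rule lift_rearrangement[OF balanced[of A]])
  obtain b where b: "b \<in> set perms" "map (entry b) (map (\<lambda>t. entry t B) w1) \<in> set normal_words"
    using count[OF w1(1)] balanced[of B] by (metis normal_word)
  define w2 where "w2 = map (relabel (A, B, C) b (A, B, C)) w1"
  define b2 where "b2 = map (entry b) (map (\<lambda>t. entry t B) w1)"
  have w2: "map first_two w2 = zip aabbcc b2"
    using w1(2) unfolding first_two_zip by (simp add: w2_def b2_def o_def)
  obtain a c p where p: "a \<in> set perms" "c \<in> set perms" "p \<in> set pair_words"
      "mset (map (relabel_pair a c) (zip aabbcc b2)) = mset p"
    using pair_word_check b(2) unfolding b2_def[symmetric] list_all_iff found_iff rearranged_iff by blast
  define w3 where "w3 = map (relabel a c (A, B, C)) w2"
  have "map first_two w3 = map (relabel_pair a c) (map first_two w2)"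
    by (simp add: w3_def)
  then have "mset (map first_two w3) = mset p"
    unfolding w2 p(4)[symmetric] by (rule arg_cong)
  then obtain w4 where w4: "mset w4 = mset w3" "map first_two w4 = p"
    by (rule lift_rearrangement)
  have "map (\<lambda>t. entry t C) w3 = map (\<lambda>t. entry t C) w1"
    by (simp add: w3_def w2_def)
  then have "mset (map (\<lambda>t. entry t C) w4) = mset aabbcc"
    using count[OF w4(1)] count[OF w1(1)] balanced[of C] by metis
  then obtain d where d: "d \<in> set perms" "map (entry d) (map (\<lambda>t. entry t C) w4) \<in> set normal_words"
    by (rule normal_word)
  define w5 where "w5 = map (relabel (A, B, C) (A, B, C) d) w4"
  have "relabel_pair (A, B, C) (A, B, C) q = q" for q by (cases q) simp
  then have "map first_two w5 = p" using w4(2) by (simp add: w5_def o_def)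
  moreover have "map (\<lambda>t. entry t C) w5 = map (entry d) (map (\<lambda>t. entry t C) w4)"
    by (simp add: w5_def)
  ultimately have "w5 = map2 (\<lambda>(x, y) z. (x, y, z)) p (map (entry d) (map (\<lambda>t. entry t C) w4))"
    using word_from_pairs[of w5] by simp
  then obtain v where v: "v \<in> set [rep1, rep2, rep3, rep4, rep5, rep6, rep7, rep8]" "same_orbit w5 v"
    using triple_word_check p(3) d(2) unfolding list_all_iff found_iff Let_def by metis
  have "equivalent (cells_idx w) (cells_idx w1)" using w1(1) by (intro rearr) simp
  also have "equivalent \<dots> (cells_idx w2)"
    unfolding w2_def by (intro equivalent_sym[OF equivalent_relabel]) (simp_all add: b)
  also have "equivalent \<dots> (cells_idx w3)"
    unfolding w3_def by (intro equivalent_sym[OF equivalent_relabel]) (simp_all add: p)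
  also have "equivalent \<dots> (cells_idx w4)" using w4(1) by (intro rearr) simp
  also have "equivalent \<dots> (cells_idx w5)"
    unfolding w5_def by (intro equivalent_sym[OF equivalent_relabel]) (simp_all add: d)
  also have "equivalent \<dots> (cells_idx v)" using v(2) by (rule same_orbit_equivalent)
  finally show ?thesis by (rule that[OF v(1)])
qed

lemma count_list_map_index: "count_list (map index xs) (index x) = count_list xs x"
  by (induction xs) simp_all

lemma nonzero_classification:
  assumes T: "invariant_form T" "length ws = 6" "T ws \<noteq> 0"
  obtains v where "v \<in> set [rep1, rep2, rep3, rep4, rep5, rep6, rep7, rep8]" "equivalent ws (cells_idx v)"
proof -
  have "\<exists>w. ws = cells_idx w"
    unfolding ex_map_conv using cell_idx_surj by metis
  then obtain w where w: "cells_idx w = ws" by blast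
  have "mset (map (\<lambda>t. entry t s) w) = mset aabbcc" for s
  proof (rule multiset_eqI)
    fix x
    have "2 = count_list (map (\<lambda>t. component t (index s)) ws) (index x)"
      using invariant_form_balanced[OF T] by simp
    also have "\<dots> = count_list (map index (map (\<lambda>t. entry t s) w)) (index x)"
      by (simp add: component_cell_idx o_def flip: w)
    also have "\<dots> = count (mset (map (\<lambda>t. entry t s) w)) x"
      unfolding count_list_map_index count_mset ..
    finally show "count (mset (map (\<lambda>t. entry t s) w)) x = count (mset aabbcc) x"
      by (cases x) simp_all
  qed
  then show ?thesis using classification that w by metis
qed

section \<open>The invariant of degree six\<close>
lemma rearrangements_cells:
  assumes "length w = 6"
  shows "rearrangements (cells_idx w) = 720 div (\<Prod>t\<in>set w. fact (count_list w t))"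
proof -
  have inj: "inj cell_idx" by (auto simp: inj_def)
  have "(\<Prod>i\<in>set_mset (mset (cells_idx w)). fact (count (mset (cells_idx w)) i)) =
      (\<Prod>t\<in>set w. fact (count (image_mset cell_idx (mset w)) (cell_idx t)) :: nat)"
    using inj by (simp add: prod.reindex inj_on_subset)
  also have "\<dots> = (\<Prod>t\<in>set w. fact (count_list w t))"
    unfolding count_image_inj[OF inj] by (simp add: count_mset)
  finally show ?thesis
    using assms unfolding rearrangements_def card_permutations_of_multiset(1)
    by (simp add: fact_numeral)
qed

lemma length_reps:
  "length rep1 = 6" "length rep2 = 6" "length rep3 = 6" "length rep4 = 6"
  "length rep5 = 6" "length rep6 = 6" "length rep7 = 6" "length rep8 = 6"
  by (simp_all add: rep_defs)

lemma rearrangements_reps: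
  "rearrangements (cells_idx rep1) = 720" "rearrangements (cells_idx rep2) = 720"
  "rearrangements (cells_idx rep3) = 360" "rearrangements (cells_idx rep4) = 90"
  "rearrangements (cells_idx rep5) = 720" "rearrangements (cells_idx rep6) = 720"
  "rearrangements (cells_idx rep7) = 360" "rearrangements (cells_idx rep8) = 720"
  using length_reps by (simp_all add: rearrangements_cells) (simp_all add: rep_defs flip: numeral_2_eq_2)

lemma lookup_numeral_times:
  "Poly_Mapping.lookup (numeral n * p) m = numeral n * Poly_Mapping.lookup (p :: cpoly) m"
proof -
  have "const (of_nat k) = of_nat k" for k by (induction k) simp_all
  from this[of "numeral n"] have "numeral n = const (numeral n)" by simp
  then show ?thesis by (metis lookup_const_times)
qed

abbreviation rep_orbit_sum :: "cell list \<Rightarrow> cpoly" where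
  "rep_orbit_sum v \<equiv> \<O>\<^sup>+ (Poly_Mapping.single (exponent_of (cells_idx v)) 1)"

text \<open>
  Coefficients are compared at a word \<open>ws\<close>. In the orbit of a representative \<open>v\<close> of ratio \<open>r\<close>, the
  coefficient of \<open>f\<close> is \<open>r\<close> times the number of rearrangements of \<open>v\<close>, times the value of the form
  at the diagonal word; the first two factors give \<open>90\<close> times the stated integer. For example,
  \<open>rep1\<close> has ratio \<open>- 5 / 4\<close> and \<open>720\<close> rearrangements, and \<open>- 5 / 4 * 720 = 90 * (- 10)\<close>. Outside
  the eight orbits both sides vanish.
\<close>
lemma invariant_eq_orbit_sums:
  assumes "homogeneous 6 f" and "SL_invariant f"
  shows "f = const (90 * polar f (cells_idx diagonal)) *
    (- 10 * rep_orbit_sum rep1 - 4 * rep_orbit_sum rep2 - 2 * rep_orbit_sum rep3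
     + rep_orbit_sum rep4 + 2 * rep_orbit_sum rep5 + 2 * rep_orbit_sum rep6
     + 4 * rep_orbit_sum rep7 + 8 * rep_orbit_sum rep8)" (is "f = ?rhs")
proof (rule poly_mapping_eqI)
  define T where "T = polar f"
  define x where "x = T (cells_idx diagonal)"
  have T: "invariant_form T"
    unfolding T_def using assms by (rule invariant_form_polar)
  fix m
  obtain ws where ws: "exponent_of ws = m" "length ws = (\<Sum>t\<in>UNIV. Poly_Mapping.lookup m t)"
    by (rule ex_word)
  have coeff: "Poly_Mapping.lookup f m = T ws * of_nat (rearrangements ws)"
    using rearrangements_pos[of ws] by (simp add: T_def polar_def ws(1))
  have known: "Poly_Mapping.lookup f m = r * x * of_nat (rearrangements (cells_idx v))"
    if "ratio v r" "equivalent ws (cells_idx v)" for v r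
    using ratio_equivalent[OF T that] rearrangements_equivalent[OF that(2)]
    by (simp add: coeff x_def)
  have orbit: "Poly_Mapping.lookup (\<O>\<^sup>+ (Poly_Mapping.single (exponent_of (cells_idx v)) 1)) m =
      of_bool (equivalent ws (cells_idx v))" for v
    using orbit_sum_word[of "cells_idx v" ws] by (simp add: ws(1))
  have trace: "gram_cube_trace share ws = gram_cube_trace share_cells v"
    if "equivalent ws (cells_idx v)" for v
    using gram_cube_trace_equivalent[OF that] by (simp add: trace_cells)
  let ?E = "\<lambda>v. of_bool (equivalent ws (cells_idx v)) :: complex"
  have "Poly_Mapping.lookup f m = 90 * x *
     (- 10 * ?E rep1 - 4 * ?E rep2 - 2 * ?E rep3 + ?E rep4 + 2 * ?E rep5 + 2 * ?E rep6 + 4 * ?E rep7 + 8 * ?E rep8)"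
  proof (cases "\<exists>v\<in>set [rep1, rep2, rep3, rep4, rep5, rep6, rep7, rep8]. equivalent ws (cells_idx v)")
    case True
    \<comment> \<open>The traces are distinct, so at most one of the eight equivalences holds.\<close>
    have sep: "equivalent ws (cells_idx rep1) \<longrightarrow> gram_cube_trace share ws = 324"
      "equivalent ws (cells_idx rep2) \<longrightarrow> gram_cube_trace share ws = 372"
      "equivalent ws (cells_idx rep3) \<longrightarrow> gram_cube_trace share ws = 504"
      "equivalent ws (cells_idx rep4) \<longrightarrow> gram_cube_trace share ws = 648"
      "equivalent ws (cells_idx rep5) \<longrightarrow> gram_cube_trace share ws = 432"
      "equivalent ws (cells_idx rep6) \<longrightarrow> gram_cube_trace share ws = 396"
      "equivalent ws (cells_idx rep7) \<longrightarrow> gram_cube_trace share ws = 456"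
      "equivalent ws (cells_idx rep8) \<longrightarrow> gram_cube_trace share ws = 336"
      using trace traces by simp_all
    from True consider "equivalent ws (cells_idx rep1)" | "equivalent ws (cells_idx rep2)"
      | "equivalent ws (cells_idx rep3)" | "equivalent ws (cells_idx rep4)" | "equivalent ws (cells_idx rep5)"
      | "equivalent ws (cells_idx rep6)" | "equivalent ws (cells_idx rep7)" | "equivalent ws (cells_idx rep8)"
      by auto
    then show ?thesis
    proof cases
      case 1
      with sep known[OF rep_ratios(1) 1] show ?thesis by (auto simp: rearrangements_reps)
    next
      case 2
      with sep known[OF rep_ratios(2) 2] show ?thesis by (auto simp: rearrangements_reps)
    next
      case 3
      with sep known[OF rep_ratios(3) 3] show ?thesis by (auto simp: rearrangements_reps)
    next
      case 4
      with sep known[OF rep_ratios(4) 4] show ?thesis by (auto simp: rearrangements_reps)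
    next
      case 5
      with sep known[OF rep_ratios(5) 5] show ?thesis by (auto simp: rearrangements_reps)
    next
      case 6
      with sep known[OF rep_ratios(6) 6] show ?thesis by (auto simp: rearrangements_reps)
    next
      case 7
      with sep known[OF rep_ratios(7) 7] show ?thesis by (auto simp: rearrangements_reps)
    next
      case 8
      with sep known[OF rep_ratios(8) 8] show ?thesis by (auto simp: rearrangements_reps)
    qed
  next
    case False
    have "Poly_Mapping.lookup f m = 0"
    proof (rule ccontr)
      assume nz: "Poly_Mapping.lookup f m \<noteq> 0"
      then have "length ws = 6"
        using assms(1) by (simp add: ws(2) homogeneous_def in_keys_iff)
      moreover have "T ws \<noteq> 0" using nz by (simp add: coeff)
      ultimately show False using False nonzero_classification[OF T] by metis
    qed
    then show ?thesis using False by simp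
  qed
  then show "Poly_Mapping.lookup f m = Poly_Mapping.lookup ?rhs m"
    unfolding lookup_const_times lookup_add lookup_minus mult_minus_left lookup_uminus
      lookup_numeral_times orbit x_def T_def .
qed

lemma rep_monomials:
  "X 1 2 3 * X 1 3 2 * X 2 1 3 * X 2 3 1 * X 3 1 2 * X 3 2 1 = Poly_Mapping.single (exponent_of (cells_idx rep1)) 1"
  "X 1 3 2 * X 1 3 3 * X 2 1 3 * X 2 2 1 * X 3 1 1 * X 3 2 2 = Poly_Mapping.single (exponent_of (cells_idx rep2)) 1"
  "X 1 3 3 ^ 2 * X 2 2 1 * X 2 2 2 * X 3 1 1 * X 3 1 2 = Poly_Mapping.single (exponent_of (cells_idx rep3)) 1"
  "X 1 3 3 ^ 2 * X 2 2 2 ^ 2 * X 3 1 1 ^ 2 = Poly_Mapping.single (exponent_of (cells_idx rep4)) 1"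
  "X 1 3 2 * X 1 3 3 * X 2 2 1 * X 2 2 3 * X 3 1 1 * X 3 1 2 = Poly_Mapping.single (exponent_of (cells_idx rep5)) 1"
  "X 1 3 2 * X 1 3 3 * X 2 1 3 * X 2 2 2 * X 3 1 1 * X 3 2 1 = Poly_Mapping.single (exponent_of (cells_idx rep6)) 1"
  "X 1 3 3 ^ 2 * X 2 1 2 * X 2 2 1 * X 3 1 1 * X 3 2 2 = Poly_Mapping.single (exponent_of (cells_idx rep7)) 1"
  "X 1 2 3 * X 1 3 2 * X 2 1 3 * X 2 3 1 * X 3 1 1 * X 3 2 2 = Poly_Mapping.single (exponent_of (cells_idx rep8)) 1"
  by (simp_all add: rep_defs monomial_Cons monomial_Nil power2_eq_square mult.assoc)

theorem theorem3p4:
  fixes f :: cpoly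
  assumes "homogeneous 6 f" and "SL_invariant f"
  shows "\<exists>c. f = const c *
    (- 10 * \<O>\<^sup>+ (X 1 2 3 * X 1 3 2 * X 2 1 3 * X 2 3 1 * X 3 1 2 * X 3 2 1)
     - 4 * \<O>\<^sup>+ (X 1 3 2 * X 1 3 3 * X 2 1 3 * X 2 2 1 * X 3 1 1 * X 3 2 2)
     - 2 * \<O>\<^sup>+ (X 1 3 3 ^ 2 * X 2 2 1 * X 2 2 2 * X 3 1 1 * X 3 1 2)
     + \<O>\<^sup>+ (X 1 3 3 ^ 2 * X 2 2 2 ^ 2 * X 3 1 1 ^ 2)
     + 2 * \<O>\<^sup>+ (X 1 3 2 * X 1 3 3 * X 2 2 1 * X 2 2 3 * X 3 1 1 * X 3 1 2)
     + 2 * \<O>\<^sup>+ (X 1 3 2 * X 1 3 3 * X 2 1 3 * X 2 2 2 * X 3 1 1 * X 3 2 1)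
     + 4 * \<O>\<^sup>+ (X 1 3 3 ^ 2 * X 2 1 2 * X 2 2 1 * X 3 1 1 * X 3 2 2)
     + 8 * \<O>\<^sup>+ (X 1 2 3 * X 1 3 2 * X 2 1 3 * X 2 3 1 * X 3 1 1 * X 3 2 2))"
  unfolding rep_monomials using invariant_eq_orbit_sums[OF assms] by blast

end
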